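(* Let $(\Gamma_1,u)$ and $(\Gamma_2,v)$ be finitely generated discrete quantum groups with $n^2$ generators. If $(\Gamma_1,u)$ is a quotient of $(\Gamma_2,v)$, i.e. $\Gamma_2\twoheadrightarrow\Gamma_1$, then $n(\Gamma_2,v)\le n(\Gamma_1,u)$. In particular, if $n\ge 2$, we have $$2\sqrt2\le n(\Gamma,u)$$ for any finitely generated discrete quantum group $(\Gamma,u)$ with $n^2$ generators. Here $n(\cdot,\cdot)$ denotes the operator norm of the self-adjoint main character, defined in the context.
   Context: An (algebraic) compact quantum group $\mathbb{G}$ is a Hopf $*$-algebra $\mathrm{Pol}(\mathbb{G})$ over $\mathbb{C}$ with comultiplication $\Delta$ which admits a unital positive linear functional $h:\mathrm{Pol}(\mathbb{G})\to\mathbb{C}$ (the Haar state; it is unique and faithful) with $(h\otimes\mathrm{id})\Delta=h(\cdot)1=(\mathrm{id}\otimes h)\Delta$. It is a compact matrix quantum group with fundamental representation $u=(u_{ij})_{i,j=1}^n\in M_n(\mathrm{Pol}(\mathbb{G}))$ if $u$ is unitary, $\Delta(u_{ij})=\sum_{k=1}^n u_{ik}\otimes u_{kj}$ for all $i,j$, the entries $u_{ij}$ generate $\mathrm{Pol}(\mathbb{G})$ as a unital $*$-algebra, and $u^c=(u_{ij}^* )_{i,j=1}^n$ is invertible in $M_n(\mathrm{Pol}(\mathbb{G}))$. A finitely generated discrete quantum group $(\Gamma,u)$ with $n^2$ generators is by definition the Pontryagin dual of a compact matrix quantum group $\mathbb{G}$ with fundamental representation $u\in M_n(\mathrm{Pol}(\mathbb{G}))$;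 all data about $(\Gamma,u)$ are expressed in terms of $(\mathrm{Pol}(\mathbb{G}),\Delta,u)$. For $(\Gamma_1,u)$, $(\Gamma_2,v)$ with duals $\mathbb{G}_1,\mathbb{G}_2$ and fundamental representations of the same size $n$, one says that $(\Gamma_1,u)$ is a quotient of $(\Gamma_2,v)$, written $\Gamma_2\twoheadrightarrow\Gamma_1$, if there is a $*$-homomorphism $\phi:\mathrm{Pol}(\mathbb{G}_2)\to\mathrm{Pol}(\mathbb{G}_1)$ with $\phi(v_{ij})=u_{ij}$ for all $i,j$. With $\chi_{\Gamma,u}=\sum_{i=1}^n u_{ii}$, set $m_k(\Gamma,u)=h\big((\chi_{\Gamma,u}+\chi_{\Gamma,u}^* )^k\big)$ and $n(\Gamma,u)=\lim_{k\to\infty}m_{2k}(\Gamma,u)^{\frac1{2k}}$ (the operator norm of $\chi_{\Gamma,u}+\chi_{\Gamma,u}^*$ in the GNS representation of $h$). *)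

theory Defs
  imports "HOL-Analysis.Analysis" "HOL-Library.Poly_Mapping"
begin

section \<open>Complex vector spaces and complex unital *-algebras\<close>

class complex_vector = ab_group_add +
  fixes scaleC :: "complex \<Rightarrow> 'a \<Rightarrow> 'a"  (infixr \<open>*\<^sub>C\<close> 75)
  assumes scaleC_add_right: "c *\<^sub>C (x + y) = c *\<^sub>C x + c *\<^sub>C y"
    and scaleC_add_left: "(c + d) *\<^sub>C x = c *\<^sub>C x + d *\<^sub>C x"
    and scaleC_scaleC [simp]: "c *\<^sub>C (d *\<^sub>C x) = (c * d) *\<^sub>C x"
    and scaleC_one [simp]: "1 *\<^sub>C x = x"

class complex_star_algebra = complex_vector + ring_1 +
  fixes star :: "'a \<Rightarrow> 'a"
  assumes scaleC_mult_left: "(c *\<^sub>C x) * y = c *\<^sub>C (x * y)"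
    and scaleC_mult_right: "x * (c *\<^sub>C y) = c *\<^sub>C (x * y)"
    and star_add: "star (x + y) = star x + star y"
    and star_scaleC: "star (c *\<^sub>C x) = cnj c *\<^sub>C star x"
    and star_mult: "star (x * y) = star y * star x"
    and star_star [simp]: "star (star x) = x"

instantiation complex :: complex_star_algebra
begin
definition scaleC_complex :: "complex \<Rightarrow> complex \<Rightarrow> complex"
  where "scaleC_complex c x = c * x"
definition star_complex :: "complex \<Rightarrow> complex"
  where "star_complex = cnj"
instance
  by standard (auto simp: scaleC_complex_def star_complex_def algebra_simps)
end

interpretation complex_vector: vector_space "scaleC :: complex \<Rightarrow> 'a \<Rightarrow> 'a::complex_vector"
  by standard (auto simp: scaleC_add_right scaleC_add_left)

abbreviation clinear :: "('a::complex_vector \<Rightarrow> 'b::complex_vector) \<Rightarrow> bool"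
  where "clinear \<equiv> Vector_Spaces.linear scaleC scaleC"

lemma clinearI:
  assumes "\<And>x y. f (x + y) = f x + f y" "\<And>c x. f (c *\<^sub>C x) = c *\<^sub>C f x"
  shows "clinear f"
  by (intro Vector_Spaces.linear.intro module_hom.intro module_hom_axioms.intro assms
      complex_vector.vector_space_axioms complex_vector.module_axioms)

lemma clinearD:
  assumes "clinear f"
  shows "f (x + y) = f x + f y" "f (c *\<^sub>C x) = c *\<^sub>C f x"
  using assms by (auto dest: Vector_Spaces.linear.axioms(3) simp: module_hom_def module_hom_axioms_def)

lemma star_one [simp]: "star 1 = (1 :: 'a::complex_star_algebra)"
  by (metis mult.left_neutral mult.right_neutral star_mult star_star)

definition algebra_hom :: "('a::complex_star_algebra \<Rightarrow> 'b::complex_star_algebra) \<Rightarrow> bool"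
  where "algebra_hom f \<longleftrightarrow> clinear f \<and> f 1 = 1 \<and> (\<forall>x y. f (x * y) = f x * f y)"

definition star_hom :: "('a::complex_star_algebra \<Rightarrow> 'b::complex_star_algebra) \<Rightarrow> bool"
  where "star_hom f \<longleftrightarrow> algebra_hom f \<and> (\<forall>x. f (star x) = star (f x))"

definition star_subalgebra :: "'a::complex_star_algebra set \<Rightarrow> bool"
  where "star_subalgebra B \<longleftrightarrow> complex_vector.subspace B \<and> 1 \<in> B \<and>
    (\<forall>x\<in>B. \<forall>y\<in>B. x * y \<in> B) \<and> (\<forall>x\<in>B. star x \<in> B)"


section \<open>The algebraic tensor product\<close>

text \<open>The tensor product over the complex numbers is the free abelian group on the Cartesian
  product modulo the usual relations. As the relations are balanced rather than linear, the
  universal property applies to complex linear and to conjugate linear maps alike.\<close>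

inductive_set tensor_rel :: "('a::complex_vector \<times> 'b::complex_vector \<Rightarrow>\<^sub>0 int) set"
  where
    zero: "0 \<in> tensor_rel"
  | diff: "x \<in> tensor_rel \<Longrightarrow> y \<in> tensor_rel \<Longrightarrow> x - y \<in> tensor_rel"
  | add_left: "frag_of (a + a', b) - frag_of (a, b) - frag_of (a', b) \<in> tensor_rel"
  | add_right: "frag_of (a, b + b') - frag_of (a, b) - frag_of (a, b') \<in> tensor_rel"
  | scale: "frag_of (c *\<^sub>C a, b) - frag_of (a, c *\<^sub>C b) \<in> tensor_rel"

lemma tensor_rel_uminus: "x \<in> tensor_rel \<Longrightarrow> - x \<in> tensor_rel"
  using tensor_rel.diff[OF tensor_rel.zero, of x] by simp

lemma tensor_rel_add: "x \<in> tensor_rel \<Longrightarrow> y \<in> tensor_rel \<Longrightarrow> x + y \<in> tensor_rel"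
  using tensor_rel.diff[OF _ tensor_rel_uminus, of x y] by simp

quotient_type (overloaded) ('a, 'b) tensor =
  "'a::complex_vector \<times> 'b::complex_vector \<Rightarrow>\<^sub>0 int" / "\<lambda>x y. x - y \<in> tensor_rel"
proof (rule equivpI)
  show "reflp (\<lambda>x y. x - y \<in> tensor_rel)"
    by (auto simp: reflp_def tensor_rel.zero)
  show "symp (\<lambda>x y. x - y \<in> tensor_rel)"
    by (metis (no_types, lifting) minus_diff_eq sympI tensor_rel_uminus)
  show "transp (\<lambda>x y. x - y \<in> tensor_rel)"
    by (rule transpI) (metis (no_types, lifting) add_diff_eq diff_add_cancel tensor_rel_add)
qed

lift_definition tensor_of :: "'a::complex_vector \<Rightarrow> 'b::complex_vector \<Rightarrow> ('a, 'b) tensor"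
  (infixr \<open>\<otimes>\<close> 75) is "\<lambda>a b. frag_of (a, b)" .

instantiation tensor :: (complex_vector, complex_vector) ab_group_add
begin
lift_definition zero_tensor :: "('a, 'b) tensor" is 0 .
lift_definition plus_tensor :: "('a, 'b) tensor \<Rightarrow> ('a, 'b) tensor \<Rightarrow> ('a, 'b) tensor"
  is "(+)" by (metis add_diff_add tensor_rel_add)
lift_definition minus_tensor :: "('a, 'b) tensor \<Rightarrow> ('a, 'b) tensor \<Rightarrow> ('a, 'b) tensor"
  is "(-)"
proof -
  fix x x' y y' :: "'a \<times> 'b \<Rightarrow>\<^sub>0 int"
  assume "x - x' \<in> tensor_rel" "y - y' \<in> tensor_rel"
  from tensor_rel.diff[OF this] show "x - y - (x' - y') \<in> tensor_rel"
    by (simp add: algebra_simps)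
qed
lift_definition uminus_tensor :: "('a, 'b) tensor \<Rightarrow> ('a, 'b) tensor"
  is "uminus" by (metis minus_diff_minus tensor_rel_uminus)
instance
  by standard (transfer; simp add: tensor_rel.zero algebra_simps)+
end

lemma tensor_add_left: "(a + a') \<otimes> b = a \<otimes> b + a' \<otimes> b"
  by transfer (metis tensor_rel.add_left diff_diff_eq)

lemma tensor_add_right: "a \<otimes> (b + b') = a \<otimes> b + a \<otimes> b'"
  by transfer (metis tensor_rel.add_right diff_diff_eq)

lemma tensor_balanced: "(c *\<^sub>C a) \<otimes> b = a \<otimes> (c *\<^sub>C b)"
  by transfer (rule tensor_rel.scale)

lemma tensor_zero_left [simp]: "0 \<otimes> b = 0"
  using tensor_add_left[of 0 0 b] by simp

lemma tensor_zero_right [simp]: "a \<otimes> 0 = 0"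
  using tensor_add_right[of a 0 0] by simp

lemma tensor_minus_left: "(- a) \<otimes> b = - (a \<otimes> b)"
  using tensor_add_left[of a "- a" b] by (simp add: eq_neg_iff_add_eq_0 add.commute)

lemma tensor_induct [case_names tensor add]:
  assumes "\<And>a b. P (a \<otimes> b)" and add: "\<And>x y. P x \<Longrightarrow> P y \<Longrightarrow> P (x + y)"
  shows "P t"
proof -
  have "P (abs_tensor r) \<and> P (- abs_tensor r)" for r
    using subset_UNIV[of "Poly_Mapping.keys r"]
  proof (induction r rule: frag_induction)
    case zero
    have "P 0" using assms(1)[of 0 0] by simp
    then show ?case by (metis minus_zero zero_tensor.abs_eq)
  next
    case (one x)
    have "abs_tensor (frag_of x) = fst x \<otimes> snd x"
      by (simp add: tensor_of.abs_eq)
    then show ?case by (metis assms(1) tensor_minus_left)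
  next
    case (diff a b)
    have "abs_tensor (a - b) = abs_tensor a + - abs_tensor b"
      by (simp add: minus_tensor.abs_eq[symmetric])
    moreover have "- abs_tensor (a - b) = - abs_tensor a + abs_tensor b"
      by (simp add: minus_tensor.abs_eq[symmetric])
    ultimately show ?case using diff add by metis
  qed
  then show ?thesis by (induct t rule: tensor.abs_induct) blast
qed

definition balanced :: "('a::complex_vector \<Rightarrow> 'b::complex_vector \<Rightarrow> 'c::complex_vector) \<Rightarrow> bool"
  where "balanced f \<longleftrightarrow> (\<forall>a a' b. f (a + a') b = f a b + f a' b) \<and>
    (\<forall>a b b'. f a (b + b') = f a b + f a b') \<and> (\<forall>c a b. f (c *\<^sub>C a) b = f a (c *\<^sub>C b))"

definition frag_lift :: "('x \<Rightarrow> 'c::complex_vector) \<Rightarrow> ('x \<Rightarrow>\<^sub>0 int) \<Rightarrow> 'c"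
  where "frag_lift g r = (\<Sum>p\<in>Poly_Mapping.keys r. of_int (Poly_Mapping.lookup r p) *\<^sub>C g p)"

text \<open>The map on the tensor product induced by a balanced \<open>f\<close>. For balanced \<open>f\<close> the value does not
  depend on the representative, see \<open>tensor_lift_tensor\<close> and \<open>tensor_lift_add\<close>.\<close>

definition tensor_lift ::
    "('a::complex_vector \<Rightarrow> 'b::complex_vector \<Rightarrow> 'c::complex_vector) \<Rightarrow> ('a, 'b) tensor \<Rightarrow> 'c"
  where "tensor_lift f t = frag_lift (\<lambda>p. f (fst p) (snd p)) (rep_tensor t)"

lemma frag_lift_add: "frag_lift g (x + y) = frag_lift g x + frag_lift g y"
  unfolding frag_lift_def
  by (rule setsum_keys_plus_distrib) (auto simp: scaleC_add_left)

lemma frag_lift_uminus: "frag_lift g (- x) = - frag_lift g x"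
  by (simp add: frag_lift_def sum_negf)

lemma frag_lift_diff: "frag_lift g (x - y) = frag_lift g x - frag_lift g y"
  using frag_lift_add[of g x "- y"] by (simp add: frag_lift_uminus)

lemma frag_lift_of [simp]: "frag_lift g (frag_of p) = g p"
  by (simp add: frag_lift_def)

lemma frag_lift_tensor_rel:
  assumes "balanced f" "r \<in> tensor_rel"
  shows "frag_lift (\<lambda>p. f (fst p) (snd p)) r = 0"
  using assms(2)
proof induction
  case zero
  then show ?case by (simp add: frag_lift_def)
qed (use assms(1) in \<open>auto simp: frag_lift_diff balanced_def\<close>)

lemma tensor_lift_abs:
  assumes "balanced f"
  shows "tensor_lift f (abs_tensor r) = frag_lift (\<lambda>p. f (fst p) (snd p)) r"
proof -
  have "rep_tensor (abs_tensor r) - r \<in> tensor_rel"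
    using Quotient3_rep_abs[OF Quotient3_tensor, of r] by (simp add: tensor_rel.zero)
  from frag_lift_tensor_rel[OF assms this] show ?thesis
    by (simp add: frag_lift_diff tensor_lift_def)
qed

lemma tensor_lift_tensor:
  "balanced f \<Longrightarrow> tensor_lift f (a \<otimes> b) = f a b"
  by (simp add: tensor_of.abs_eq tensor_lift_abs)

lemma tensor_lift_add:
  assumes "balanced f"
  shows "tensor_lift f (s + t) = tensor_lift f s + tensor_lift f t"
  by (induct s rule: tensor.abs_induct, induct t rule: tensor.abs_induct)
    (simp add: plus_tensor.abs_eq tensor_lift_abs[OF assms] frag_lift_add)

lemma tensor_eqI:
  assumes "\<And>x y. f (x + y) = f x + f y" "\<And>x y. g (x + y) = g x + g y"
    and "\<And>a b. f (a \<otimes> b) = g (a \<otimes> b)"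
  shows "f t = g t"
  by (induction t rule: tensor_induct) (simp_all add: assms)

instantiation tensor :: (complex_vector, complex_vector) complex_vector
begin
lift_definition scaleC_tensor :: "complex \<Rightarrow> ('a, 'b) tensor \<Rightarrow> ('a, 'b) tensor"
  is "\<lambda>c. frag_extend (\<lambda>p. frag_of (c *\<^sub>C fst p, snd p))"
proof -
  fix c :: complex and x y :: "'a \<times> 'b \<Rightarrow>\<^sub>0 int"
  have "frag_extend (\<lambda>p. frag_of (c *\<^sub>C fst p, snd p)) r \<in> tensor_rel"
    if "r \<in> tensor_rel" for r :: "'a \<times> 'b \<Rightarrow>\<^sub>0 int"
    using that
  proof induction
    case (scale d a b)
    show ?case
      using tensor_rel.scale[of d "c *\<^sub>C a" b] by (simp add: frag_extend_diff mult.commute)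
  next
    case (diff x y)
    then show ?case by (simp add: frag_extend_diff tensor_rel.diff)
  qed (simp_all add: frag_extend_diff scaleC_add_right tensor_rel.zero tensor_rel.add_left
      tensor_rel.add_right)
  then show "frag_extend (\<lambda>p. frag_of (c *\<^sub>C fst p, snd p)) x -
      frag_extend (\<lambda>p. frag_of (c *\<^sub>C fst p, snd p)) y \<in> tensor_rel"
    if "x - y \<in> tensor_rel"
    using that unfolding frag_extend_diff[symmetric] by blast
qed

lemma scaleC_tensor_tensor: "c *\<^sub>C (a \<otimes> b) = (c *\<^sub>C a) \<otimes> b"
  by transfer (simp add: tensor_rel.zero)

instance
proof
  fix c d :: complex and x y :: "('a, 'b) tensor"
  show add: "c *\<^sub>C (x + y) = c *\<^sub>C x + c *\<^sub>C y" for c and x y :: "('a, 'b) tensor"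
    by transfer (simp add: frag_extend_add tensor_rel.zero)
  show "(c + d) *\<^sub>C x = c *\<^sub>C x + d *\<^sub>C x"
    by (rule tensor_eqI[where t = x])
      (simp_all add: add scaleC_tensor_tensor scaleC_add_left tensor_add_left add_ac)
  show "c *\<^sub>C (d *\<^sub>C x) = (c * d) *\<^sub>C x"
    by (rule tensor_eqI[where t = x]) (simp_all add: add scaleC_tensor_tensor)
  show "1 *\<^sub>C x = x"
    by (rule tensor_eqI[where t = x]) (simp_all add: add scaleC_tensor_tensor)
qed
end

lemma scaleC_tensor_right: "c *\<^sub>C (a \<otimes> b) = a \<otimes> (c *\<^sub>C b)"
  by (simp add: scaleC_tensor_tensor tensor_balanced)

lemma balanced_pointwise:
  assumes "\<And>a b. balanced (\<lambda>a' b'. f a b a' b')"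
    and "\<And>a' b'. balanced (\<lambda>a b. f a b a' b')"
  shows "balanced (\<lambda>a b. tensor_lift (\<lambda>a' b'. f a b a' b') y)"
proof -
  let ?F = "\<lambda>a b. tensor_lift (\<lambda>a' b'. f a b a' b') y"
  note bal = tensor_lift_add[OF assms(1)] tensor_lift_tensor[OF assms(1)]
  note f = assms(2)[unfolded balanced_def]
  have "?F (a + a') b = ?F a b + ?F a' b" for a a' b
    by (rule tensor_eqI[where t = y], simp_all only: bal add_ac) (simp_all add: f)
  moreover have "?F a (b + b') = ?F a b + ?F a b'" for a b b'
    by (rule tensor_eqI[where t = y], simp_all only: bal add_ac) (simp_all add: f)
  moreover have "?F (c *\<^sub>C a) b = ?F a (c *\<^sub>C b)" for c a b
    by (rule tensor_eqI[where t = y], simp_all only: bal) (simp_all add: f)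
  ultimately show ?thesis
    unfolding balanced_def by blast
qed

lemma linear_functional_one:
  obtains g :: "'a::complex_star_algebra \<Rightarrow> complex" where "clinear g" "g 1 = 1"
proof -
  interpret vector_space_pair "scaleC :: complex \<Rightarrow> 'a \<Rightarrow> 'a" "scaleC :: complex \<Rightarrow> complex \<Rightarrow> complex"
    by standard
  have "complex_vector.independent {1 :: 'a}"
    by simp
  from linear_independent_extend[OF this, of "\<lambda>_. 1"] that show ?thesis by auto
qed

instantiation tensor :: (complex_star_algebra, complex_star_algebra) complex_star_algebra
begin
definition one_tensor :: "('a, 'b) tensor"
  where "one_tensor = 1 \<otimes> 1"
definition times_tensor :: "('a, 'b) tensor \<Rightarrow> ('a, 'b) tensor \<Rightarrow> ('a, 'b) tensor"
  where "times_tensor x y =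
    tensor_lift (\<lambda>a b. tensor_lift (\<lambda>a' b'. (a * a') \<otimes> (b * b')) y) x"
definition star_tensor :: "('a, 'b) tensor \<Rightarrow> ('a, 'b) tensor"
  where "star_tensor = tensor_lift (\<lambda>a b. star a \<otimes> star b)"

lemma balanced_times_tensor:
  "balanced (\<lambda>a' b'. ((a :: 'a) * a') \<otimes> ((b :: 'b) * b'))"
  "balanced (\<lambda>a b. ((a :: 'a) * a') \<otimes> ((b :: 'b) * b'))"
  by (auto simp: balanced_def tensor_add_left tensor_add_right algebra_simps
      scaleC_mult_left scaleC_mult_right tensor_balanced)

lemma times_tensor_tensor: "(a \<otimes> b) * (a' \<otimes> b') = ((a :: 'a) * a') \<otimes> ((b :: 'b) * b')"
  unfolding times_tensor_def
  by (simp add: tensor_lift_tensor balanced_pointwise balanced_times_tensor)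

lemma times_tensor_add_left: "(x + y) * z = x * z + y * (z :: ('a, 'b) tensor)"
  unfolding times_tensor_def
  by (simp add: tensor_lift_add balanced_pointwise balanced_times_tensor)

lemma times_tensor_left:
  "(a \<otimes> b) * y = tensor_lift (\<lambda>a' b'. ((a :: 'a) * a') \<otimes> ((b :: 'b) * b')) y"
  unfolding times_tensor_def
  by (simp add: tensor_lift_tensor balanced_pointwise balanced_times_tensor)

lemma times_tensor_add_right: "x * (y + z) = x * y + x * (z :: ('a, 'b) tensor)"
  by (rule tensor_eqI[where t = x])
    (simp_all add: times_tensor_left tensor_lift_add balanced_times_tensor
      times_tensor_add_left add_ac)

lemma balanced_star_tensor: "balanced (\<lambda>a b. star (a :: 'a) \<otimes> star (b :: 'b))"
  by (auto simp: balanced_def tensor_add_left tensor_add_right star_add star_scaleC tensor_balanced)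

lemma star_tensor_tensor: "star (a \<otimes> b) = star (a :: 'a) \<otimes> star (b :: 'b)"
  unfolding star_tensor_def by (simp add: tensor_lift_tensor balanced_star_tensor)

lemma star_tensor_add: "star (x + y) = star x + star (y :: ('a, 'b) tensor)"
  unfolding star_tensor_def by (simp add: tensor_lift_add balanced_star_tensor)

lemma one_tensor_nonzero: "(1 :: ('a, 'b) tensor) \<noteq> 0"
proof -
  obtain f :: "'a \<Rightarrow> complex" where f: "clinear f" "f 1 = 1" by (rule linear_functional_one)
  obtain g :: "'b \<Rightarrow> complex" where g: "clinear g" "g 1 = 1" by (rule linear_functional_one)
  have bal: "balanced (\<lambda>a b. f a * g b)"
    using clinearD[OF f(1)] clinearD[OF g(1)]
    by (auto simp: balanced_def algebra_simps scaleC_complex_def)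
  have "tensor_lift (\<lambda>a b. f a * g b) 1 = 1"
    by (simp add: one_tensor_def tensor_lift_tensor[OF bal] f g)
  moreover have "tensor_lift (\<lambda>a b. f a * g b) 0 = 0"
    using tensor_lift_add[OF bal, of 0 0] by simp
  ultimately show ?thesis by auto
qed

instance
proof
  fix c :: complex and x y z :: "('a, 'b) tensor"
  note add = times_tensor_add_left times_tensor_add_right star_tensor_add scaleC_add_right
  note tensor = times_tensor_tensor star_tensor_tensor scaleC_tensor_tensor
  show "x * y * z = x * (y * z)"
  proof (rule tensor_eqI[where t = x])
    fix a b show "a \<otimes> b * y * z = a \<otimes> b * (y * z)"
    proof (rule tensor_eqI[where t = y])
      fix a' b' show "a \<otimes> b * a' \<otimes> b' * z = a \<otimes> b * (a' \<otimes> b' * z)"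
        by (rule tensor_eqI[where t = z]) (simp_all add: add tensor mult.assoc)
    qed (simp_all add: add)
  qed (simp_all add: add)
  show "1 * x = x"
    by (rule tensor_eqI[where t = x]) (simp_all add: add tensor one_tensor_def)
  show "x * 1 = x"
    by (rule tensor_eqI[where t = x]) (simp_all add: add tensor one_tensor_def)
  show "(x + y) * z = x * z + y * z" "x * (y + z) = x * y + x * z"
    by (rule times_tensor_add_left times_tensor_add_right)+
  show "(0 :: ('a, 'b) tensor) \<noteq> 1"
    using one_tensor_nonzero by metis
  show "(c *\<^sub>C x) * y = c *\<^sub>C (x * y)"
  proof (rule tensor_eqI[where t = x])
    fix a b show "(c *\<^sub>C (a \<otimes> b)) * y = c *\<^sub>C (a \<otimes> b * y)"
      by (rule tensor_eqI[where t = y]) (simp_all add: add tensor scaleC_mult_left)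
  qed (simp_all add: add)
  show "x * (c *\<^sub>C y) = c *\<^sub>C (x * y)"
  proof (rule tensor_eqI[where t = x])
    fix a b show "a \<otimes> b * (c *\<^sub>C y) = c *\<^sub>C (a \<otimes> b * y)"
      by (rule tensor_eqI[where t = y]) (simp_all add: add tensor scaleC_mult_right)
  qed (simp_all add: add)
  show "star (x + y) = star x + star y"
    by (rule star_tensor_add)
  show "star (c *\<^sub>C x) = cnj c *\<^sub>C star x"
    by (rule tensor_eqI[where t = x]) (simp_all add: add tensor star_scaleC)
  show "star (x * y) = star y * star x"
  proof (rule tensor_eqI[where t = x])
    fix a b show "star (a \<otimes> b * y) = star y * star (a \<otimes> b)"
      by (rule tensor_eqI[where t = y]) (simp_all add: add tensor star_mult)
  qed (simp_all add: add)
  show "star (star x) = x"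
    by (rule tensor_eqI[where t = x]) (simp_all add: add tensor)
qed
end

definition tensor_map ::
    "('a::complex_vector \<Rightarrow> 'c::complex_vector) \<Rightarrow> ('b::complex_vector \<Rightarrow> 'd::complex_vector) \<Rightarrow>
      ('a, 'b) tensor \<Rightarrow> ('c, 'd) tensor"
  where "tensor_map f g = tensor_lift (\<lambda>a b. f a \<otimes> g b)"

definition tensor_assoc ::
    "(('a::complex_vector, 'b::complex_vector) tensor, 'c::complex_vector) tensor \<Rightarrow>
      ('a, ('b, 'c) tensor) tensor"
  where "tensor_assoc = tensor_lift (\<lambda>t c. tensor_lift (\<lambda>a b. a \<otimes> (b \<otimes> c)) t)"


section \<open>Compact quantum groups\<close>

definition counit ::
    "('a::complex_star_algebra \<Rightarrow> ('a, 'a) tensor) \<Rightarrow> ('a \<Rightarrow> complex) \<Rightarrow> bool"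
  where "counit \<Delta> \<epsilon> \<longleftrightarrow> algebra_hom \<epsilon> \<and>
    (\<forall>a. tensor_lift (\<lambda>x y. \<epsilon> x *\<^sub>C y) (\<Delta> a) = a) \<and>
    (\<forall>a. tensor_lift (\<lambda>x y. \<epsilon> y *\<^sub>C x) (\<Delta> a) = a)"

definition antipode ::
    "('a::complex_star_algebra \<Rightarrow> ('a, 'a) tensor) \<Rightarrow> ('a \<Rightarrow> complex) \<Rightarrow> ('a \<Rightarrow> 'a) \<Rightarrow> bool"
  where "antipode \<Delta> \<epsilon> S \<longleftrightarrow> clinear S \<and>
    (\<forall>a. tensor_lift (\<lambda>x y. S x * y) (\<Delta> a) = \<epsilon> a *\<^sub>C 1) \<and>
    (\<forall>a. tensor_lift (\<lambda>x y. x * S y) (\<Delta> a) = \<epsilon> a *\<^sub>C 1)"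

text \<open>Counit and antipode are determined by the comultiplication, so they are not part of the data.
  Compatibility of both with the involution is automatic.\<close>

definition hopf_star_algebra :: "('a::complex_star_algebra \<Rightarrow> ('a, 'a) tensor) \<Rightarrow> bool"
  where "hopf_star_algebra \<Delta> \<longleftrightarrow> star_hom \<Delta> \<and>
    (\<forall>a. tensor_assoc (tensor_map \<Delta> id (\<Delta> a)) = tensor_map id \<Delta> (\<Delta> a)) \<and>
    (\<exists>\<epsilon> S. counit \<Delta> \<epsilon> \<and> antipode \<Delta> \<epsilon> S)"

definition is_haar_state ::
    "('a::complex_star_algebra \<Rightarrow> ('a, 'a) tensor) \<Rightarrow> ('a \<Rightarrow> complex) \<Rightarrow> bool"
  where "is_haar_state \<Delta> h \<longleftrightarrow> clinear h \<and> h 1 = 1 \<and> (\<forall>a. h (star a * a) \<in> \<real>\<^sub>\<ge>\<^sub>0) \<and>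
    (\<forall>a. tensor_lift (\<lambda>x y. h x *\<^sub>C y) (\<Delta> a) = h a *\<^sub>C 1) \<and>
    (\<forall>a. tensor_lift (\<lambda>x y. h y *\<^sub>C x) (\<Delta> a) = h a *\<^sub>C 1)"

definition compact_quantum_group :: "('a::complex_star_algebra \<Rightarrow> ('a, 'a) tensor) \<Rightarrow> bool"
  where "compact_quantum_group \<Delta> \<longleftrightarrow> hopf_star_algebra \<Delta> \<and> (\<exists>h. is_haar_state \<Delta> h)"

lemma balanced_functional:
  assumes "clinear h"
  shows "balanced (\<lambda>x y. h x *\<^sub>C y)" "balanced (\<lambda>x y. h y *\<^sub>C x)"
  using clinearD[OF assms]
  by (auto simp: balanced_def scaleC_add_left scaleC_add_right scaleC_complex_def mult.commute)

lemma is_haar_state_unique: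
  assumes "is_haar_state \<Delta> h" "is_haar_state \<Delta> h'"
  shows "h = h'"
proof
  fix a
  have h: "clinear h" and h': "clinear h'" using assms by (auto simp: is_haar_state_def)
  note lin = clinearD[OF h] clinearD[OF h']
  note bal = balanced_functional[OF h] balanced_functional[OF h']
  have "h' (tensor_lift (\<lambda>x y. h x *\<^sub>C y) t) = h (tensor_lift (\<lambda>x y. h' y *\<^sub>C x) t)" for t
    by (rule tensor_eqI[where t = t])
      (simp_all add: lin tensor_lift_add tensor_lift_tensor bal scaleC_complex_def)
  from this[of "\<Delta> a"] have "h' (h a *\<^sub>C 1) = h (h' a *\<^sub>C 1)"
    using assms by (simp add: is_haar_state_def)
  then show "h a = h' a"
    using assms by (simp add: lin is_haar_state_def scaleC_complex_def)
qed

definition haar_state :: "('a::complex_star_algebra \<Rightarrow> ('a, 'a) tensor) \<Rightarrow> 'a \<Rightarrow> complex"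
  where "haar_state \<Delta> = (THE h. is_haar_state \<Delta> h)"

lemma haar_state: "compact_quantum_group \<Delta> \<Longrightarrow> is_haar_state \<Delta> (haar_state \<Delta>)"
  unfolding haar_state_def compact_quantum_group_def
  by (metis is_haar_state_unique theI)

definition adjoint_matrix :: "'a::complex_star_algebra^'n^'m \<Rightarrow> 'a^'m^'n"
  where "adjoint_matrix u = (\<chi> i j. star (u $ j $ i))"

definition conj_matrix :: "'a::complex_star_algebra^'n^'m \<Rightarrow> 'a^'n^'m"
  where "conj_matrix u = (\<chi> i j. star (u $ i $ j))"

definition unitary_matrix :: "'a::complex_star_algebra^'n^'n \<Rightarrow> bool"
  where "unitary_matrix u \<longleftrightarrow> u ** adjoint_matrix u = mat 1 \<and> adjoint_matrix u ** u = mat 1"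

definition compact_matrix_quantum_group ::
    "('a::complex_star_algebra \<Rightarrow> ('a, 'a) tensor) \<Rightarrow> 'a^'n^'n \<Rightarrow> bool"
  where "compact_matrix_quantum_group \<Delta> u \<longleftrightarrow> compact_quantum_group \<Delta> \<and>
    unitary_matrix u \<and>
    (\<forall>i j. \<Delta> (u $ i $ j) = (\<Sum>k\<in>UNIV. u $ i $ k \<otimes> u $ k $ j)) \<and>
    star_subalgebra hull {u $ i $ j | i j. True} = UNIV \<and>
    invertible (conj_matrix u)"


section \<open>Finitely generated discrete quantum groups\<close>

text \<open>A finitely generated discrete quantum group \<open>(\<Gamma>, u)\<close> with \<open>n\<^sup>2\<close> generators is given by its dual,
  that is, by the pair \<open>(\<Delta>, u)\<close> with \<open>\<Delta>\<close> the comultiplication on \<open>Pol(G)\<close>; the algebra \<open>Pol(\<bbbG>)\<close> is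
  the type \<open>'a\<close>, and \<open>n\<close> is the cardinality of \<open>'n\<close>.\<close>

abbreviation fg_discrete_quantum_group ::
    "('a::complex_star_algebra \<Rightarrow> ('a, 'a) tensor) \<Rightarrow> 'a^'n^'n \<Rightarrow> bool"
  where "fg_discrete_quantum_group \<equiv> compact_matrix_quantum_group"

text \<open>\<open>is_quotient_of u v\<close>: the group with generators \<open>u\<close> is a quotient of the one with generators \<open>v\<close>.
  The comultiplications do not enter: compatibility with them is automatic on generators.\<close>

definition is_quotient_of ::
    "'a::complex_star_algebra^'n^'n \<Rightarrow> 'b::complex_star_algebra^'n^'n \<Rightarrow> bool"
  where "is_quotient_of u v \<longleftrightarrow>
    (\<exists>\<phi> :: 'b \<Rightarrow> 'a. star_hom \<phi> \<and> (\<forall>i j. \<phi> (v $ i $ j) = u $ i $ j))"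

definition main_character :: "'a::complex_star_algebra^'n^'n \<Rightarrow> 'a"
  where "main_character u = (\<Sum>i\<in>UNIV. u $ i $ i)"

definition character_moment ::
    "('a::complex_star_algebra \<Rightarrow> ('a, 'a) tensor) \<Rightarrow> 'a^'n^'n \<Rightarrow> nat \<Rightarrow> complex"
  where "character_moment \<Delta> u k =
    haar_state \<Delta> ((main_character u + star (main_character u)) ^ k)"

text \<open>The even moments are nonnegative real numbers because the element is self-adjoint, so passing to
  the real part loses nothing.\<close>

definition character_norm ::
    "('a::complex_star_algebra \<Rightarrow> ('a, 'a) tensor) \<Rightarrow> 'a^'n^'n \<Rightarrow> real"
  where "character_norm \<Delta> u = lim (\<lambda>k. root (2 * k) (Re (character_moment \<Delta> u (2 * k))))"

end

theory Submission
  imports Defs "HOL-Real_Asymp.Real_Asymp"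
begin

text \<open>Every moment is the character of a tensor power \<open>W\<close> of \<open>u \<oplus> u\<^sup>c\<close>, integrated against the Haar
  state, hence the trace of the idempotent matrix \<open>h(W)\<close>, that is, the dimension of the fixed vectors of
  \<open>W\<close>. A quotient map sends fixed vectors to fixed vectors, so the moments can only grow under it.

  For the bound \<open>2 * sqrt 2\<close>, the invariant vectors of \<open>u \<otimes> u\<^sup>c\<close> and \<open>u\<^sup>c \<otimes> u\<close> yield one fixed vector of
  the \<open>2k\<close>-th power for every noncrossing pairing of \<open>2k\<close> points whose blocks carry one of two colours.
  If \<open>n \<ge> 2\<close> there are product functionals, one for each pairing, against which these vectors are
  triangular. Hence the \<open>2k\<close>-th moment is at least \<open>2\<^sup>k\<close> times the \<open>k\<close>-th Catalan number.\<close>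

section \<open>Traces of idempotent matrices\<close>

definition idempotent_on :: "'i set \<Rightarrow> ('i \<Rightarrow> 'i \<Rightarrow> 'f::field) \<Rightarrow> bool"
  where "idempotent_on A P \<longleftrightarrow> (\<forall>i\<in>A. \<forall>k\<in>A. (\<Sum>j\<in>A. P i j * P j k) = P i k)"

text \<open>The rank one idempotent \<open>\<xi> i * \<theta> k / c\<close> is absorbed by
  \<open>P\<close> on both sides, so subtracting it leaves an idempotent; its own trace is
  1.\<close>

lemma idempotent_on_deflate:
  fixes P :: "'i \<Rightarrow> 'i \<Rightarrow> 'f::field"
  assumes P: "idempotent_on A P"
    and \<xi>: "\<And>i. i \<in> A \<Longrightarrow> (\<Sum>j\<in>A. P i j * \<xi> j) = \<xi> i"
    and \<theta>: "\<And>k. k \<in> A \<Longrightarrow> (\<Sum>j\<in>A. \<theta> j * P j k) = \<theta> k"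
    and c: "c = (\<Sum>j\<in>A. \<theta> j * \<xi> j)" "c \<noteq> 0"
  shows "idempotent_on A (\<lambda>i k. P i k - \<xi> i * \<theta> k / c)"
    and "(\<Sum>i\<in>A. P i i - \<xi> i * \<theta> i / c) = (\<Sum>i\<in>A. P i i) - 1"
proof -
  show "idempotent_on A (\<lambda>i k. P i k - \<xi> i * \<theta> k / c)"
    unfolding idempotent_on_def
  proof (intro ballI)
    fix i k assume ik: "i \<in> A" "k \<in> A"
    have "(\<Sum>j\<in>A. (P i j - \<xi> i * \<theta> j / c) * (P j k - \<xi> j * \<theta> k / c)) =
        (\<Sum>j\<in>A. P i j * P j k) - (\<Sum>j\<in>A. P i j * \<xi> j) * \<theta> k / c
        - \<xi> i * (\<Sum>j\<in>A. \<theta> j * P j k) / c + \<xi> i * (\<Sum>j\<in>A. \<theta> j * \<xi> j) * \<theta> k / c / c"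
      by (simp add: sum_distrib_left sum_distrib_right sum_divide_distrib
          sum_subtractf[symmetric] sum.distrib[symmetric] algebra_simps)
    also have "\<dots> = P i k - \<xi> i * \<theta> k / c"
      using ik P \<xi> \<theta> c by (simp add: idempotent_on_def)
    finally show "(\<Sum>j\<in>A. (P i j - \<xi> i * \<theta> j / c) * (P j k - \<xi> j * \<theta> k / c))
        = P i k - \<xi> i * \<theta> k / c" .
  qed
  have "(\<Sum>i\<in>A. \<xi> i * \<theta> i / c) = 1"
    using c by (simp add: sum_divide_distrib[symmetric] mult.commute)
  then show "(\<Sum>i\<in>A. P i i - \<xi> i * \<theta> i / c) = (\<Sum>i\<in>A. P i i) - 1"
    by (simp add: sum_subtractf)
qed

text \<open>The trace of an idempotent is its rank, read in the field. The induction runs over the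
  number of nonzero columns: each deflation clears at least one and creates none.\<close>

lemma idempotent_on_trace_nat:
  fixes P :: "'i \<Rightarrow> 'i \<Rightarrow> 'f::field"
  assumes "finite A" "idempotent_on A P"
  shows "\<exists>m \<le> card A. (\<Sum>i\<in>A. P i i) = of_nat m"
proof -
  have "\<exists>m \<le> card {k \<in> A. \<exists>i\<in>A. P i k \<noteq> 0}. (\<Sum>i\<in>A. P i i) = of_nat m"
    using assms(2)
  proof (induction "card {k \<in> A. \<exists>i\<in>A. P i k \<noteq> 0}" arbitrary: P rule: less_induct)
    case less
    show ?case
    proof (cases "\<exists>a\<in>A. \<exists>b\<in>A. P a b \<noteq> 0")
      case False
      then show ?thesis by (intro exI[of _ 0]) auto
    next
      case True
      then obtain a b where ab: "a \<in> A" "b \<in> A" "P a b \<noteq> 0" by blast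
      \<comment> \<open>By idempotence \<open>P\<close> fixes its column \<open>b\<close> from the
        left and its row \<open>a\<close> from the right, and these two pair to
        \<open>P a b\<close>; so this is a deflation.\<close>
      define Q where "Q = (\<lambda>i k. P i k - P i b * P a k / P a b)"
      have id: "(\<Sum>j\<in>A. P i j * P j k) = P i k" if "i \<in> A" "k \<in> A" for i k
        using less.prems that by (simp add: idempotent_on_def)
      note deflate = idempotent_on_deflate[OF less.prems, of "\<lambda>i. P i b" "P a" "P a b", folded Q_def]
      have Q: "idempotent_on A Q" "(\<Sum>i\<in>A. Q i i) = (\<Sum>i\<in>A. P i i) - 1"
        using deflate ab id by (simp_all add: Q_def)
      have "Q i b = 0" for i
        using ab by (simp add: Q_def)
      moreover have "Q i k = 0" if "\<forall>i\<in>A. P i k = 0" "i \<in> A" for i k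
        using that ab by (simp add: Q_def)
      ultimately have "{k \<in> A. \<exists>i\<in>A. Q i k \<noteq> 0} \<subset> {k \<in> A. \<exists>i\<in>A. P i k \<noteq> 0}"
        using ab by blast
      then have card: "card {k \<in> A. \<exists>i\<in>A. Q i k \<noteq> 0} < card {k \<in> A. \<exists>i\<in>A. P i k \<noteq> 0}"
        using assms(1) by (intro psubset_card_mono) auto
      from less.hyps[OF this Q(1)] obtain m
        where "m \<le> card {k \<in> A. \<exists>i\<in>A. Q i k \<noteq> 0}" "(\<Sum>i\<in>A. Q i i) = of_nat m" by blast
      with card Q(2) show ?thesis
        by (intro exI[of _ "Suc m"]) (auto simp: algebra_simps)
    qed
  qed
  then obtain m where m: "m \<le> card {k \<in> A. \<exists>i\<in>A. P i k \<noteq> 0}" "(\<Sum>i\<in>A. P i i) = of_nat m"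
    by blast
  have "card {k \<in> A. \<exists>i\<in>A. P i k \<noteq> 0} \<le> card A"
    using assms(1) by (intro card_mono) auto
  with m show ?thesis by (meson le_trans)
qed

text \<open>The range of \<open>Q\<close> lies in that of \<open>P\<close>. Passing to
  \<open>R = Q P\<close>, which has the same trace, gives an idempotent absorbed by \<open>P\<close>
  on both sides, so \<open>P - R\<close> is idempotent and its trace is a natural number.\<close>

lemma idempotent_on_trace_mono:
  fixes P Q :: "'i \<Rightarrow> 'i \<Rightarrow> 'f::field"
  assumes "finite A" and P: "idempotent_on A P" and Q: "idempotent_on A Q"
    and PQ: "\<And>i k. i \<in> A \<Longrightarrow> k \<in> A \<Longrightarrow> (\<Sum>j\<in>A. P i j * Q j k) = Q i k"
  shows "\<exists>m. (\<Sum>i\<in>A. P i i) = (\<Sum>i\<in>A. Q i i) + of_nat m"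
proof -
  define R where "R = (\<lambda>i k. \<Sum>j\<in>A. Q i j * P j k)"
  have PR: "(\<Sum>j\<in>A. P i j * R j k) = R i k" if "i \<in> A" "k \<in> A" for i k
  proof -
    have "(\<Sum>j\<in>A. P i j * R j k) = (\<Sum>l\<in>A. (\<Sum>j\<in>A. P i j * Q j l) * P l k)"
      unfolding R_def sum_distrib_left sum_distrib_right by (subst sum.swap) (simp add: mult.assoc)
    then show ?thesis using that by (simp add: PQ R_def)
  qed
  have RP: "(\<Sum>j\<in>A. R i j * P j k) = R i k" if "i \<in> A" "k \<in> A" for i k
  proof -
    have "(\<Sum>j\<in>A. R i j * P j k) = (\<Sum>l\<in>A. Q i l * (\<Sum>j\<in>A. P l j * P j k))"
      unfolding R_def sum_distrib_left sum_distrib_right by (subst sum.swap) (simp add: mult.assoc)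
    then show ?thesis using that P by (simp add: idempotent_on_def R_def)
  qed
  have RR: "(\<Sum>j\<in>A. R i j * R j k) = R i k" if "i \<in> A" "k \<in> A" for i k
  proof -
    have "(\<Sum>j\<in>A. R i j * R j k) = (\<Sum>l\<in>A. Q i l * (\<Sum>j\<in>A. P l j * R j k))"
      \<comment> \<open>Fixing the row \<open>i\<close> expands only the left factor of the
        product.\<close>
      unfolding fun_cong[OF fun_cong[OF R_def], of i] sum_distrib_left sum_distrib_right
      by (subst sum.swap) (simp add: mult.assoc)
    also have "\<dots> = (\<Sum>l\<in>A. Q i l * R l k)" using that by (simp add: PR)
    also have "\<dots> = (\<Sum>j\<in>A. (\<Sum>l\<in>A. Q i l * Q l j) * P j k)"
      unfolding R_def sum_distrib_left sum_distrib_right by (subst sum.swap) (simp add: mult.assoc)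
    finally show ?thesis using that Q by (simp add: idempotent_on_def R_def)
  qed
  have "idempotent_on A (\<lambda>i k. P i k - R i k)"
    unfolding idempotent_on_def
    using P PR RP RR by (simp add: algebra_simps sum.distrib sum_subtractf idempotent_on_def)
  from idempotent_on_trace_nat[OF assms(1) this] obtain m
    where "(\<Sum>i\<in>A. P i i) = (\<Sum>i\<in>A. R i i) + of_nat m"
    by (auto simp: sum_subtractf algebra_simps)
  moreover have "(\<Sum>i\<in>A. R i i) = (\<Sum>i\<in>A. \<Sum>j\<in>A. P i j * Q j i)"
    unfolding R_def by (subst sum.swap) (simp add: mult.commute)
  ultimately show ?thesis using PQ by auto
qed

text \<open>Triangularity makes the fixed vectors \<open>\<xi> d\<close> independent. They are
  deflated away one at a time, beginning with an \<open>R\<close>-minimal \<open>d\<close>: its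
  \<open>\<theta> d\<close> annihilates every other \<open>\<xi> e\<close>, so these stay
  fixed.\<close>

lemma card_le_idempotent_on_trace:
  fixes P :: "'i \<Rightarrow> 'i \<Rightarrow> 'f::field" and \<xi> \<theta> :: "'d \<Rightarrow> 'i \<Rightarrow> 'f"
  assumes "finite A" "finite D" "wf R" "idempotent_on A P"
    and "\<And>d i. d \<in> D \<Longrightarrow> i \<in> A \<Longrightarrow> (\<Sum>j\<in>A. P i j * \<xi> d j) = \<xi> d i"
    and tri: "\<And>d e. d \<in> D \<Longrightarrow> e \<in> D \<Longrightarrow> (\<Sum>j\<in>A. \<theta> d j * \<xi> e j) \<noteq> 0 \<Longrightarrow> d = e \<or> (e, d) \<in> R"
    and diag: "\<And>d. d \<in> D \<Longrightarrow> (\<Sum>j\<in>A. \<theta> d j * \<xi> d j) \<noteq> 0"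
  shows "\<exists>m. (\<Sum>i\<in>A. P i i) = of_nat (card D + m)"
  using assms(2,4-)
proof (induction "card D" arbitrary: D P)
  case 0
  then show ?case using idempotent_on_trace_nat[OF assms(1)] by auto
next
  case (Suc n)
  from Suc.hyps(2) have "D \<noteq> {}" by auto
  with \<open>wf R\<close> obtain d where d: "d \<in> D" "\<And>e. (e, d) \<in> R \<Longrightarrow> e \<notin> D"
    unfolding wf_eq_minimal by (metis all_not_in_conv)
  \<comment> \<open>Composing \<open>\<theta> d\<close> with \<open>P\<close> yields a row fixed by
    \<open>P\<close>, as deflation requires, without changing its values on the
    \<open>\<xi> e\<close>.\<close>
  define \<tau> where "\<tau> = (\<lambda>k. \<Sum>j\<in>A. \<theta> d j * P j k)"
  have \<tau>\<xi>: "(\<Sum>k\<in>A. \<tau> k * \<xi> e k) = (\<Sum>j\<in>A. \<theta> d j * \<xi> e j)" if "e \<in> D" for e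
  proof -
    have "(\<Sum>k\<in>A. \<tau> k * \<xi> e k) = (\<Sum>j\<in>A. \<theta> d j * (\<Sum>k\<in>A. P j k * \<xi> e k))"
      unfolding \<tau>_def sum_distrib_left sum_distrib_right by (subst sum.swap) (simp add: mult.assoc)
    then show ?thesis using that Suc.prems(3) by simp
  qed
  have \<tau>P: "(\<Sum>j\<in>A. \<tau> j * P j k) = \<tau> k" if "k \<in> A" for k
  proof -
    have "(\<Sum>j\<in>A. \<tau> j * P j k) = (\<Sum>l\<in>A. \<theta> d l * (\<Sum>j\<in>A. P l j * P j k))"
      unfolding \<tau>_def sum_distrib_left sum_distrib_right by (subst sum.swap) (simp add: mult.assoc)
    then show ?thesis using that Suc.prems(2) by (simp add: idempotent_on_def \<tau>_def)
  qed
  define c where "c = (\<Sum>j\<in>A. \<tau> j * \<xi> d j)"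
  have c: "c \<noteq> 0" using Suc.prems(5)[OF d(1)] \<tau>\<xi>[OF d(1)] by (simp add: c_def)
  note deflate = idempotent_on_deflate[OF Suc.prems(2) Suc.prems(3)[OF d(1)] \<tau>P c_def c]
  have "\<exists>m. (\<Sum>i\<in>A. P i i - \<xi> d i * \<tau> i / c) = of_nat (card (D - {d}) + m)"
  proof (rule Suc.hyps(1)[where P = "\<lambda>i k. P i k - \<xi> d i * \<tau> k / c"])
    show "n = card (D - {d})" using Suc.hyps(2) d(1) Suc.prems(1) by simp
    show "finite (D - {d})" using Suc.prems(1) by simp
    show "idempotent_on A (\<lambda>i k. P i k - \<xi> d i * \<tau> k / c)" by (rule deflate)
    show "(\<Sum>j\<in>A. (P i j - \<xi> d i * \<tau> j / c) * \<xi> e j) = \<xi> e i" if "e \<in> D - {d}" "i \<in> A" for e i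
    proof -
      have "(\<Sum>j\<in>A. \<theta> d j * \<xi> e j) = 0"
        using that d Suc.prems(4) by blast
      then have "(\<Sum>j\<in>A. \<tau> j * \<xi> e j) = 0"
        using \<tau>\<xi> that by simp
      moreover have "(\<Sum>j\<in>A. (P i j - \<xi> d i * \<tau> j / c) * \<xi> e j) =
          (\<Sum>j\<in>A. P i j * \<xi> e j) - \<xi> d i / c * (\<Sum>j\<in>A. \<tau> j * \<xi> e j)"
        by (simp add: sum_distrib_left sum_subtractf[symmetric] algebra_simps)
      ultimately show ?thesis using that Suc.prems(3) by simp
    qed
  qed (use Suc.prems(4,5) in auto)
  then obtain m where "(\<Sum>i\<in>A. P i i) - 1 = of_nat (card (D - {d}) + m)"
    using deflate(2) by auto
  then have "(\<Sum>i\<in>A. P i i) = of_nat (card (D - {d}) + m) + 1"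
    by (simp add: algebra_simps)
  moreover have "card D = Suc (card (D - {d}))"
    using d(1) Suc.prems(1) by (metis card.remove)
  ultimately show ?case by (intro exI[of _ m]) simp
qed

section \<open>Corepresentations and the Haar state\<close>

lemma clinear_sum: "clinear f \<Longrightarrow> f (\<Sum>x\<in>A. g x) = (\<Sum>x\<in>A. f (g x))"
  by (rule module_hom.sum[OF Vector_Spaces.linear.axioms(3)])

lemma clinear_zero: "clinear f \<Longrightarrow> f 0 = 0"
  using clinearD(2)[of f 0 0] by simp

lemma tensor_lift_sum:
  assumes "balanced f"
  shows "tensor_lift f (\<Sum>x\<in>A. g x) = (\<Sum>x\<in>A. tensor_lift f (g x))"
proof (induction A rule: infinite_finite_induct)
  case (insert x A)
  then show ?case by (simp add: tensor_lift_add[OF assms])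
qed (use tensor_lift_add[OF assms, of 0 0] in auto)

lemma star_zero [simp]: "star (0 :: 'a::complex_star_algebra) = 0"
  using star_add[of 0 "0 :: 'a"] by simp

lemma star_sum: "star (\<Sum>x\<in>A. g x) = (\<Sum>x\<in>A. star (g x :: 'a::complex_star_algebra))"
  by (induction A rule: infinite_finite_induct) (simp_all add: star_add)

lemma star_power: "star (x ^ k) = star (x :: 'a::complex_star_algebra) ^ k"
  by (induction k) (simp_all add: star_mult power_commutes)

section \<open>Positive functionals and the Cauchy-Schwarz inequality\<close>

locale positive_functional =
  fixes h :: "'a::complex_star_algebra \<Rightarrow> complex"
  assumes linear: "clinear h" and positive: "h (star a * a) \<in> \<real>\<^sub>\<ge>\<^sub>0"
begin

lemma cauchy_schwarz: "(cmod (h (star a * b)))\<^sup>2 \<le> Re (h (star a * a)) * Re (h (star b * b))"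
proof -
  define A B q r where "A = h (star a * a)" and "B = h (star b * b)"
    and "q = h (star a * b)" and "r = h (star b * a)"
  note h = clinearD[OF linear]
  have *: "h (star (a + c *\<^sub>C b) * (a + c *\<^sub>C b)) = A + c * q + cnj c * r + cnj c * c * B" for c
    by (simp add: star_add star_scaleC scaleC_mult_left scaleC_mult_right h scaleC_complex_def
        A_def B_def q_def r_def algebra_simps)
  have pos: "A + c * q + cnj c * r + cnj c * c * B \<in> \<real>\<^sub>\<ge>\<^sub>0" for c
    using positive[of "a + c *\<^sub>C b"] unfolding * .
  have AB: "A \<in> \<real>\<^sub>\<ge>\<^sub>0" "B \<in> \<real>\<^sub>\<ge>\<^sub>0"
    by (simp_all add: A_def B_def positive)
  \<comment> \<open>Reality of the value at \<open>c = 1\<close> and at \<open>c = \<i>\<close>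
    determines \<open>r\<close>.\<close>
  have r: "r = cnj q"
    using pos[of 1] pos[of \<i>] AB by (simp add: complex_nonneg_Reals_iff complex_eq_iff)
  \<comment> \<open>Substituting \<open>c = - t * cnj q\<close> gives a real quadratic in
    \<open>t\<close>; its minimiser \<open>1 / Re B\<close> is inserted at the end.\<close>
  have le: "0 \<le> Re A - 2 * t * (cmod q)\<^sup>2 + t\<^sup>2 * (cmod q)\<^sup>2 * Re B" for t :: real
  proof -
    have N: "cnj q * q = complex_of_real ((cmod q)\<^sup>2)"
      by (simp only: complex_norm_square mult.commute)
    have *: "A + c * q + cnj c * r + cnj c * c * B =
        A - 2 * t * (cnj q * q) + t\<^sup>2 * (cnj q * q) * B" if "c = - t * cnj q" for c
      unfolding that r by (simp add: power2_eq_square algebra_simps)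
    have "A - 2 * t * (cnj q * q) + t\<^sup>2 * (cnj q * q) * B \<in> \<real>\<^sub>\<ge>\<^sub>0"
      using pos[of "- t * cnj q"] unfolding *[OF refl] .
    then show ?thesis
      unfolding N by (simp add: complex_nonneg_Reals_iff)
  qed
  show ?thesis
  proof (cases "Re B = 0")
    case True
    show ?thesis
    proof (cases "q = 0")
      case False
      then show ?thesis
        \<comment> \<open>With \<open>Re B = 0\<close> the bound is affine in \<open>t\<close>, and
          this \<open>t\<close> makes it equal to -1.\<close>
        using le[of "(Re A + 1) / (2 * (cmod q)\<^sup>2)"] True by (simp add: field_simps)
    qed (use AB in \<open>simp add: A_def B_def q_def complex_nonneg_Reals_iff\<close>)
  next
    case False
    then have "Re B > 0" using AB by (simp add: complex_nonneg_Reals_iff)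
    moreover have "(1 / Re B)\<^sup>2 * (cmod q)\<^sup>2 * Re B = (cmod q)\<^sup>2 / Re B"
      using False by (simp add: power2_eq_square)
    with le[of "1 / Re B"] have "(cmod q)\<^sup>2 / Re B \<le> Re A" by simp
    ultimately have "(cmod q)\<^sup>2 \<le> Re A * Re B" by (simp add: pos_divide_le_eq)
    then show ?thesis by (simp only: A_def B_def q_def)
  qed
qed

end

lemma haar_positive_functional: "is_haar_state \<Delta> h \<Longrightarrow> positive_functional h"
  by (simp add: is_haar_state_def positive_functional_def)

text \<open>The index set is a parameter because the words of a fixed length form a set, not a
  type.\<close>

definition corep ::
    "('a::complex_star_algebra \<Rightarrow> ('a, 'a) tensor) \<Rightarrow> 'i set \<Rightarrow> ('i \<Rightarrow> 'i \<Rightarrow> 'a) \<Rightarrow> bool"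
  where "corep \<Delta> A w \<longleftrightarrow> (\<forall>i\<in>A. \<forall>j\<in>A. \<Delta> (w i j) = (\<Sum>k\<in>A. w i k \<otimes> w k j))"

context
  fixes \<Delta> :: "'a::complex_star_algebra \<Rightarrow> ('a, 'a) tensor" and h and A and w :: "'i \<Rightarrow> 'i \<Rightarrow> 'a"
  assumes haar: "is_haar_state \<Delta> h" and rep: "corep \<Delta> A w"
begin

text \<open>Invariance of \<open>h\<close> on the coefficient \<open>w i j\<close>. Read column by
  column: every column of the matrix of Haar integrals is a fixed vector of
  \<open>w\<close>.\<close>

lemma corep_haar_right:
  assumes "i \<in> A" "j \<in> A"
  shows "(\<Sum>k\<in>A. h (w k j) *\<^sub>C w i k) = h (w i j) *\<^sub>C 1"
proof -
  have lin: "clinear h" using haar by (simp add: is_haar_state_def)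
  have "tensor_lift (\<lambda>x y. h y *\<^sub>C x) (\<Delta> (w i j)) = h (w i j) *\<^sub>C 1"
    using haar by (simp add: is_haar_state_def)
  then show ?thesis
    using rep assms
    by (simp add: corep_def tensor_lift_sum tensor_lift_tensor balanced_functional[OF lin])
qed

text \<open>Apply \<open>h\<close> to the fixed vector equation. Together with
  \<open>corep_haar_right\<close> this makes the matrix of Haar integrals a projection onto the
  fixed vectors.\<close>

lemma corep_haar_fixed:
  assumes "\<And>i. i \<in> A \<Longrightarrow> (\<Sum>k\<in>A. \<xi> k *\<^sub>C w i k) = \<xi> i *\<^sub>C 1" "i \<in> A"
  shows "(\<Sum>k\<in>A. h (w i k) * \<xi> k) = \<xi> i"
proof -
  have lin: "clinear h" "h 1 = 1" using haar by (simp_all add: is_haar_state_def)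
  have "h (\<Sum>k\<in>A. \<xi> k *\<^sub>C w i k) = h (\<xi> i *\<^sub>C 1)"
    using assms by simp
  then show ?thesis
    by (simp add: clinear_sum[OF lin(1)] clinearD[OF lin(1)] lin(2) scaleC_complex_def mult.commute)
qed

lemma corep_haar_idempotent: "idempotent_on A (\<lambda>i j. h (w i j))"
  unfolding idempotent_on_def by (intro ballI corep_haar_fixed corep_haar_right)

end

section \<open>Tensor powers of a matrix, indexed by words\<close>

definition words :: "nat \<Rightarrow> 'i list set"
  where "words k = {I. length I = k}"

lemma words_0 [simp]: "words 0 = {[]}"
  by (auto simp: words_def)

lemma finite_words [simp]: "finite (words k :: 'i::finite list set)"
  using finite_lists_length_eq[of "UNIV :: 'i set" k] by (simp add: words_def)

lemma card_words: "card (words k :: 'i::finite list set) = CARD('i) ^ k"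
  using card_lists_length_eq[of "UNIV :: 'i set" k] by (simp add: words_def)

lemma words_Suc: "words (Suc k) = (\<lambda>(i, I). i # I) ` (UNIV \<times> words k)"
  by (auto simp: words_def length_Suc_conv)

lemma sum_words_Suc:
  "(\<Sum>I\<in>words (Suc k). f I) = (\<Sum>i\<in>UNIV. \<Sum>I\<in>words k. f (i # I))"
proof -
  have "inj_on (\<lambda>(i, I). i # I) (UNIV \<times> words k)"
    by (auto simp: inj_on_def)
  then show ?thesis
    unfolding words_Suc by (subst sum.reindex) (simp_all add: sum.cartesian_product prod.case_distrib comp_def)
qed

text \<open>\<open>map2\<close> stops at the end of the shorter word, so the value is a matrix entry
  only for words of equal length.\<close>

definition tensor_power :: "('i \<Rightarrow> 'i \<Rightarrow> 'a::monoid_mult) \<Rightarrow> 'i list \<Rightarrow> 'i list \<Rightarrow> 'a"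
  where "tensor_power w I J = prod_list (map2 w I J)"

lemma tensor_power_simps [simp]:
  "tensor_power w [] [] = 1"
  "tensor_power w (i # I) (j # J) = w i j * tensor_power w I J"
  by (simp_all add: tensor_power_def)

lemma tensor_power_append:
  "length I = length J \<Longrightarrow>
    tensor_power w (I @ I') (J @ J') = tensor_power w I J * tensor_power w I' J'"
  by (simp add: tensor_power_def)

lemma tensor_power_trace:
  fixes w :: "'i::finite \<Rightarrow> 'i \<Rightarrow> 'a::semiring_1"
  shows "(\<Sum>I\<in>words k. tensor_power w I I) = (\<Sum>i\<in>UNIV. w i i) ^ k"
  by (induction k)
    (simp_all add: sum_words_Suc sum_distrib_left[symmetric] sum_distrib_right[symmetric])

lemma times_tensor_sum:
  "(\<Sum>i\<in>A. a i \<otimes> b i) * (\<Sum>j\<in>B. c j \<otimes> d j) = (\<Sum>i\<in>A. \<Sum>j\<in>B. (a i * c j) \<otimes> (b i * d j))"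
  for a :: "'i \<Rightarrow> 'a::complex_star_algebra" and b :: "'i \<Rightarrow> 'b::complex_star_algebra"
  by (simp add: sum_product times_tensor_tensor)

lemma corep_tensor_power:
  fixes w :: "'i::finite \<Rightarrow> 'i \<Rightarrow> 'a::complex_star_algebra"
  assumes "algebra_hom \<Delta>" "corep \<Delta> UNIV w"
  shows "corep \<Delta> (words k) (tensor_power w)"
proof (induction k)
  case 0
  have "\<Delta> 1 = 1 \<otimes> 1"
    using assms(1) by (simp add: algebra_hom_def one_tensor_def)
  then show ?case by (simp add: corep_def)
next
  case (Suc k)
  have mult: "\<Delta> (x * y) = \<Delta> x * \<Delta> y" for x y
    using assms(1) by (simp add: algebra_hom_def)
  have "\<Delta> (w i j * tensor_power w I J) =
      (\<Sum>K\<in>words (Suc k). tensor_power w (i # I) K \<otimes> tensor_power w K (j # J))"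
    if "I \<in> words k" "J \<in> words k" for i j I J
  proof -
    have "\<Delta> (w i j) = (\<Sum>l\<in>UNIV. w i l \<otimes> w l j)"
      and "\<Delta> (tensor_power w I J) = (\<Sum>K\<in>words k. tensor_power w I K \<otimes> tensor_power w K J)"
      using that Suc assms(2) by (auto simp only: corep_def UNIV_I)
    then show ?thesis
      by (simp only: mult times_tensor_sum sum_words_Suc tensor_power_simps)
  qed
  then show ?case
    unfolding corep_def words_Suc[of k] by auto
qed

section \<open>Moments and quotients\<close>

text \<open>Log-convexity and \<open>a 0 = 1\<close> make the \<open>k\<close>-th root of
  \<open>a k\<close> increase with \<open>k\<close>; the bound then gives a limit.\<close>

lemma convergent_root_log_convex:
  fixes a :: "nat \<Rightarrow> real"
  assumes "a 0 = 1" and nonneg: "\<And>k. 0 \<le> a k" and log_convex: "\<And>k. (a (Suc k))\<^sup>2 \<le> a k * a (Suc (Suc k))"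
    and bound: "\<And>k. a k \<le> C ^ (2 * k)" and "0 \<le> C"
  shows "convergent (\<lambda>k. root (2 * k) (a k))"
proof -
  \<comment> \<open>Monotonicity of the roots, stated without roots so that a power of
    \<open>a (Suc k)\<close> can be cancelled in the induction; the value 0 is treated
    apart.\<close>
  have *: "a k ^ Suc k \<le> a (Suc k) ^ k" for k
  proof (induction k)
    case 0
    then show ?case using assms(1) by simp
  next
    case (Suc k)
    have "a (Suc k) ^ k * a (Suc k) ^ Suc (Suc k) = ((a (Suc k))\<^sup>2) ^ Suc k"
      by (simp add: power2_eq_square power_mult_distrib)
    also have "\<dots> \<le> (a k * a (Suc (Suc k))) ^ Suc k"
      by (intro power_mono log_convex) simp
    also have "\<dots> = a k ^ Suc k * a (Suc (Suc k)) ^ Suc k"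
      by (rule power_mult_distrib)
    also have "\<dots> \<le> a (Suc k) ^ k * a (Suc (Suc k)) ^ Suc k"
      using nonneg by (intro mult_right_mono Suc.IH) simp
    finally show ?case
      using nonneg[of "Suc k"] nonneg[of "Suc (Suc k)"]
      by (cases "a (Suc k) = 0") (simp_all add: mult_le_cancel_left_pos)
  qed
  \<comment> \<open>The shift by one keeps the degree of the root positive.\<close>
  define b where "b = (\<lambda>k. root (2 * Suc k) (a (Suc k)))"
  have b_nonneg: "0 \<le> b k" for k
    using nonneg by (simp add: b_def)
  have b_pow: "b k ^ (2 * Suc k) = a (Suc k)" for k
    unfolding b_def by (rule real_root_pow_pos2) (use nonneg in auto)
  have "b k \<le> b (Suc k)" for k
  proof -
    have "b k ^ (2 * Suc k * Suc (Suc k)) = a (Suc k) ^ Suc (Suc k)"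
      by (metis b_pow power_mult)
    also have "\<dots> \<le> a (Suc (Suc k)) ^ Suc k" by (rule *)
    also have "\<dots> = b (Suc k) ^ (2 * Suc (Suc k) * Suc k)"
      by (metis b_pow power_mult)
    also have "2 * Suc (Suc k) * Suc k = 2 * Suc k * Suc (Suc k)" by simp
    finally have "b k ^ (2 * Suc k * Suc (Suc k)) \<le> b (Suc k) ^ (2 * Suc k * Suc (Suc k))" .
    then show ?thesis
      by (subst (asm) power_mono_iff) (use b_nonneg in auto)
  qed
  then have "incseq b" by (simp add: incseq_SucI)
  moreover have "b k \<le> C" for k
  proof -
    have "b k ^ (2 * Suc k) \<le> C ^ (2 * Suc k)"
      unfolding b_pow by (rule bound)
    then show ?thesis
      by (subst (asm) power_mono_iff) (use b_nonneg \<open>0 \<le> C\<close> in auto)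
  qed
  ultimately obtain L where "b \<longlonglongrightarrow> L"
    by (metis incseq_convergent)
  then have "convergent b" by (rule convergentI)
  then show ?thesis unfolding b_def by (rule convergent_Suc_iff[of "\<lambda>k. root (2 * k) (a k)", THEN iffD1])
qed

text \<open>The corepresentation \<open>u \<oplus> u\<^sup>c\<close>; the first component of an index selects the summand.\<close>

definition double_corep :: "'a::complex_star_algebra^'n^'n \<Rightarrow> bool \<times> 'n \<Rightarrow> bool \<times> 'n \<Rightarrow> 'a"
  where "double_corep u p q =
    (if fst p \<noteq> fst q then 0
     else if fst p then u $ snd p $ snd q else star (u $ snd p $ snd q))"

lemma sum_UNIV_bool_times: "(\<Sum>p\<in>UNIV. f p) = (\<Sum>i\<in>UNIV. f (True, i)) + (\<Sum>i\<in>UNIV. f (False, i))"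
  for f :: "bool \<times> 'n::finite \<Rightarrow> 'a::comm_monoid_add"
  using sum.cartesian_product[of "\<lambda>c i. f (c, i)" UNIV UNIV]
  unfolding UNIV_Times_UNIV by (simp add: UNIV_bool add.commute)

lemma double_corep_trace: "(\<Sum>p\<in>UNIV. double_corep u p p) = main_character u + star (main_character u)"
  by (simp add: sum_UNIV_bool_times double_corep_def main_character_def star_sum)

context
  fixes \<Delta> :: "'a::complex_star_algebra \<Rightarrow> ('a, 'a) tensor" and u :: "'a^'n^'n"
  assumes qg: "fg_discrete_quantum_group \<Delta> u"
begin

lemma haar_state_fg: "is_haar_state \<Delta> (haar_state \<Delta>)"
  by (rule haar_state) (use qg in \<open>simp add: compact_matrix_quantum_group_def\<close>)

lemma corep_double: "corep \<Delta> UNIV (double_corep u)"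
proof -
  have \<Delta>: "star_hom \<Delta>" and u: "\<Delta> (u $ i $ j) = (\<Sum>k\<in>UNIV. u $ i $ k \<otimes> u $ k $ j)" for i j
    using qg by (simp_all add: compact_matrix_quantum_group_def compact_quantum_group_def hopf_star_algebra_def)
  then have "\<Delta> (star (u $ i $ j)) = (\<Sum>k\<in>UNIV. star (u $ i $ k) \<otimes> star (u $ k $ j))" for i j
    by (simp add: star_hom_def star_sum star_tensor_tensor)
  moreover have "\<Delta> 0 = 0"
    using \<Delta> by (simp add: star_hom_def algebra_hom_def clinear_zero)
  ultimately show ?thesis
    by (auto simp: corep_def sum_UNIV_bool_times double_corep_def u)
qed

lemma corep_words: "corep \<Delta> (words k) (tensor_power (double_corep u))"
  using qg by (intro corep_tensor_power corep_double)
    (simp add: compact_matrix_quantum_group_def compact_quantum_group_def hopf_star_algebra_def star_hom_def)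

lemma character_moment_trace:
  "character_moment \<Delta> u k = (\<Sum>I\<in>words k. haar_state \<Delta> (tensor_power (double_corep u) I I))"
proof -
  have "clinear (haar_state \<Delta>)" using haar_state_fg by (simp add: is_haar_state_def)
  then show ?thesis
    unfolding character_moment_def double_corep_trace[symmetric] tensor_power_trace[symmetric]
    by (rule clinear_sum)
qed

text \<open>Integrality makes the moments nonnegative reals, and the size of the idempotent matrix
  bounds their growth.\<close>

lemma character_moment_nat: "\<exists>m \<le> (2 * CARD('n)) ^ k. character_moment \<Delta> u k = of_nat m"
  using idempotent_on_trace_nat[OF finite_words corep_haar_idempotent[OF haar_state_fg corep_words]]
  by (simp add: character_moment_trace card_words)

text \<open>\<open>lim\<close> carries information only once convergence is known; this follows
  because the even moments are log-convex.\<close>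

lemma character_norm_LIMSEQ:
  "(\<lambda>k. root (2 * k) (Re (character_moment \<Delta> u (2 * k)))) \<longlonglongrightarrow> character_norm \<Delta> u"
proof -
  interpret positive_functional "haar_state \<Delta>"
    by (rule haar_positive_functional[OF haar_state_fg])
  define x where "x = main_character u + star (main_character u)"
  have x: "star x = x" by (simp add: x_def star_add add.commute)
  have moment: "character_moment \<Delta> u k = haar_state \<Delta> (x ^ k)" for k
    by (simp add: character_moment_def x_def)
  have "convergent (\<lambda>k. root (2 * k) (Re (character_moment \<Delta> u (2 * k))))"
  proof (rule convergent_root_log_convex[where C = "2 * real CARD('n)"])
    show "Re (character_moment \<Delta> u (2 * 0)) = 1"
      using haar_state_fg by (simp add: moment is_haar_state_def)
    fix k
    obtain m where m: "m \<le> (2 * CARD('n)) ^ (2 * k)" "character_moment \<Delta> u (2 * k) = of_nat m"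
      using character_moment_nat by blast
    show "0 \<le> Re (character_moment \<Delta> u (2 * k))" by (simp add: m)
    have "real m \<le> real ((2 * CARD('n)) ^ (2 * k))" using m(1) by (simp only: of_nat_le_iff)
    then show "Re (character_moment \<Delta> u (2 * k)) \<le> (2 * real CARD('n)) ^ (2 * k)"
      by (simp add: m)
    have pow: "star (x ^ i) * x ^ j = x ^ (i + j)" for i j
      by (simp add: star_power x power_add)
    have "Re (character_moment \<Delta> u (2 * Suc k)) \<le> cmod (character_moment \<Delta> u (2 * Suc k))"
      by (rule complex_Re_le_cmod)
    moreover obtain m' where "character_moment \<Delta> u (2 * Suc k) = of_nat m'"
      using character_moment_nat by blast
    ultimately have "(Re (character_moment \<Delta> u (2 * Suc k)))\<^sup>2 \<le>
        (cmod (character_moment \<Delta> u (2 * Suc k)))\<^sup>2"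
      by (intro power_mono) auto
    also have "\<dots> \<le> Re (character_moment \<Delta> u (2 * k)) * Re (character_moment \<Delta> u (2 * Suc (Suc k)))"
      \<comment> \<open>The exponent \<open>2 * Suc k\<close> is split as
        \<open>k + Suc (Suc k)\<close>, so that the neighbouring even moments appear as
        bounds.\<close>
      using cauchy_schwarz[of "x ^ k" "x ^ Suc (Suc k)"] unfolding pow moment
      by (simp add: mult_2)
    finally show "(Re (character_moment \<Delta> u (2 * Suc k)))\<^sup>2 \<le>
        Re (character_moment \<Delta> u (2 * k)) * Re (character_moment \<Delta> u (2 * Suc (Suc k)))" .
  qed simp
  then show ?thesis
    unfolding character_norm_def by (simp add: convergent_LIMSEQ_iff)
qed

end

section \<open>Moments and norms under a quotient map\<close>

lemma star_hom_tensor_power: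
  assumes "star_hom \<phi>" "\<And>i j. \<phi> (v $ i $ j) = u $ i $ j"
  shows "\<phi> (tensor_power (double_corep v) I J) = tensor_power (double_corep u) I J"
proof -
  have hom: "\<phi> 1 = 1" "\<phi> 0 = 0" "\<phi> (star x) = star (\<phi> x)" "\<phi> (x * y) = \<phi> x * \<phi> y" for x y
    using assms(1) by (simp_all add: star_hom_def algebra_hom_def clinear_zero)
  have "\<phi> (double_corep v p q) = double_corep u p q" for p q
    by (simp add: double_corep_def hom assms(2))
  then have "\<phi> (prod_list (map (\<lambda>(p, q). double_corep v p q) xs)) =
      prod_list (map (\<lambda>(p, q). double_corep u p q) xs)" for xs
    by (induction xs) (auto simp: hom)
  then show ?thesis by (simp add: tensor_power_def)
qed

text \<open>The columns of \<open>Q\<close> are scalar fixed vectors for \<open>v\<close>. Applying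
  \<open>\<phi>\<close> to their equations makes them fixed for \<open>u\<close>, so
  \<open>P\<close> leaves them unchanged and the traces compare.\<close>

lemma character_moment_mono:
  fixes u :: "'a::complex_star_algebra^'n^'n" and v :: "'b::complex_star_algebra^'n^'n"
  assumes \<Delta>: "fg_discrete_quantum_group \<Delta>\<^sub>1 u" "fg_discrete_quantum_group \<Delta>\<^sub>2 v"
    and "is_quotient_of u v"
  shows "Re (character_moment \<Delta>\<^sub>2 v k) \<le> Re (character_moment \<Delta>\<^sub>1 u k)"
proof -
  obtain \<phi> where \<phi>: "star_hom \<phi>" "\<And>i j. \<phi> (v $ i $ j) = u $ i $ j"
    using assms(3) unfolding is_quotient_of_def by blast
  then have lin: "clinear \<phi>" and one: "\<phi> 1 = 1"
    by (simp_all add: star_hom_def algebra_hom_def)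
  define P Q where "P = (\<lambda>I J. haar_state \<Delta>\<^sub>1 (tensor_power (double_corep u) I J))"
    and "Q = (\<lambda>I J. haar_state \<Delta>\<^sub>2 (tensor_power (double_corep v) I J))"
  note rep = haar_state_fg[OF \<Delta>(1)] corep_words[OF \<Delta>(1), of k]
  note rep' = haar_state_fg[OF \<Delta>(2)] corep_words[OF \<Delta>(2), of k]
  have fixed: "(\<Sum>K\<in>words k. Q K J *\<^sub>C tensor_power (double_corep u) I K) = Q I J *\<^sub>C 1"
    if "I \<in> words k" "J \<in> words k" for I J
  proof -
    have "\<phi> (\<Sum>K\<in>words k. Q K J *\<^sub>C tensor_power (double_corep v) I K) = \<phi> (Q I J *\<^sub>C 1)"
      using corep_haar_right[OF rep' that] by (simp add: Q_def)
    then show ?thesis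
      by (simp add: clinear_sum[OF lin] clinearD[OF lin] one star_hom_tensor_power[OF \<phi>])
  qed
  have "(\<Sum>K\<in>words k. P I K * Q K J) = Q I J" if "I \<in> words k" "J \<in> words k" for I J
    unfolding P_def by (rule corep_haar_fixed[OF rep fixed[OF _ that(2)] that(1)])
  then obtain m where "(\<Sum>I\<in>words k. P I I) = (\<Sum>I\<in>words k. Q I I) + of_nat m"
    using idempotent_on_trace_mono[OF finite_words, of k P Q]
      corep_haar_idempotent[OF rep] corep_haar_idempotent[OF rep'] unfolding P_def Q_def by blast
  then show ?thesis
    by (simp add: P_def Q_def character_moment_trace[OF \<Delta>(1)] character_moment_trace[OF \<Delta>(2)])
qed

lemma character_norm_quotient_le:
  fixes u :: "'a::complex_star_algebra^'n^'n" and v :: "'b::complex_star_algebra^'n^'n"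
  assumes "fg_discrete_quantum_group \<Delta>\<^sub>1 u" "fg_discrete_quantum_group \<Delta>\<^sub>2 v" "is_quotient_of u v"
  shows "character_norm \<Delta>\<^sub>2 v \<le> character_norm \<Delta>\<^sub>1 u"
proof (rule LIMSEQ_le[OF character_norm_LIMSEQ[OF assms(2)] character_norm_LIMSEQ[OF assms(1)]])
  show "\<exists>N. \<forall>k\<ge>N. root (2 * k) (Re (character_moment \<Delta>\<^sub>2 v (2 * k))) \<le>
      root (2 * k) (Re (character_moment \<Delta>\<^sub>1 u (2 * k)))"
    \<comment> \<open>Starting at 1 keeps the degree of the root positive.\<close>
    using character_moment_mono[OF assms] by (intro exI[of _ 1]) (simp add: real_root_le_mono)
qed

section \<open>Coloured noncrossing pairings\<close>

text \<open>A word over \<open>'c option\<close> encodes a noncrossing pairing with coloured blocks: \<open>Some c\<close> opens a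
  block of colour \<open>c\<close> and \<open>None\<close> closes the innermost open one. The first argument of \<open>dyck\<close> is the
  number of blocks that are already open.\<close>

fun dyck :: "nat \<Rightarrow> 'c option list \<Rightarrow> bool"
  where
    "dyck n [] \<longleftrightarrow> n = 0"
  | "dyck n (Some c # d) \<longleftrightarrow> dyck (Suc n) d"
  | "dyck n (None # d) \<longleftrightarrow> n > 0 \<and> dyck (n - 1) d"

definition dyck_words :: "nat \<Rightarrow> nat \<Rightarrow> 'c option list set"
  where "dyck_words m n = {d \<in> words m. dyck n d}"

lemma finite_dyck_words [simp]: "finite (dyck_words m n :: 'c::finite option list set)"
  by (simp add: dyck_words_def)

lemma dyck_height_le_length: "dyck n d \<Longrightarrow> n \<le> length d"
  by (induction n d rule: dyck.induct) auto

lemma dyck_words_empty: "m < n \<Longrightarrow> dyck_words m n = {}"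
  using dyck_height_le_length by (fastforce simp: dyck_words_def words_def)

text \<open>Sort by the first letter: an opening one has a free choice of colour, a closing one
  needs an open block.\<close>

lemma card_dyck_words_Suc:
  "card (dyck_words (Suc m) n :: 'c::finite option list set) =
    CARD('c) * card (dyck_words m (Suc n) :: 'c option list set) +
    (if n > 0 then card (dyck_words m (n - 1) :: 'c option list set) else 0)"
proof -
  let ?A = "(\<lambda>(c, d). Some c # d) ` (UNIV \<times> dyck_words m (Suc n)) :: 'c option list set"
  let ?B = "(if n > 0 then Cons None ` dyck_words m (n - 1) else {}) :: 'c option list set"
  have "dyck_words (Suc m) n = ?A \<union> ?B"
  proof (intro set_eqI iffI)
    fix d :: "'c option list" assume d: "d \<in> dyck_words (Suc m) n"
    then obtain a e where "d = a # e" by (auto simp: dyck_words_def words_def length_Suc_conv)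
    with d show "d \<in> ?A \<union> ?B"
      by (cases a) (auto simp: dyck_words_def words_def)
  qed (auto simp: dyck_words_def words_def split: if_splits)
  moreover have "card ?A = CARD('c) * card (dyck_words m (Suc n) :: 'c option list set)"
    by (subst card_image) (auto simp: inj_on_def card_cartesian_product)
  moreover have "card ?B = (if n > 0 then card (dyck_words m (n - 1) :: 'c option list set) else 0)"
    by (auto simp: card_image)
  moreover have "?A \<inter> ?B = {}" by auto
  ultimately show ?thesis by (simp add: card_Un_disjoint)
qed

text \<open>The ballot number \<open>(n + 1) / (a + n + 1) * (2 * a + n choose a)\<close>, times the choices of colour.\<close>

lemma card_dyck_words:
  "real (card (dyck_words (2 * a + n) n :: 'c::finite option list set)) * real (a + n + 1) =
    real CARD('c) ^ a * real (n + 1) * real ((2 * a + n) choose a)"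
proof (induction "2 * a + n" arbitrary: a n)
  case 0
  then have "a = 0" "n = 0" by auto
  moreover have "(dyck_words 0 0 :: 'c option list set) = {[]}" by (auto simp: dyck_words_def)
  ultimately show ?case by simp
next
  case (Suc m)
  let ?D = "\<lambda>m n. real (card (dyck_words m n :: 'c option list set))"
  let ?q = "real CARD('c)"
  show ?case
  proof (cases a)
    case 0
    \<comment> \<open>With \<open>a = 0\<close> all letters close, which leaves a single
      word.\<close>
    then obtain n' where n': "n = Suc n'" "m = n'" using Suc.hyps(2) by (cases n) auto
    have "?D (2 * 0 + n') n' * real (0 + n' + 1) = ?q ^ 0 * real (n' + 1) * real ((2 * 0 + n') choose 0)"
      by (rule Suc.hyps(1)) (use n' in simp)
    then have "?D n' n' = 1" by simp
    then show ?thesis using 0 n' by (simp add: card_dyck_words_Suc dyck_words_empty)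
  next
    case (Suc a')
    have m: "m = 2 * a' + Suc n" using Suc Suc.hyps(2) by simp
    define C where "C = real (m choose a)"
    have C': "real (m choose a') * real (a + n) = real a * C"
    proof -
      have "Suc a' * (m choose Suc a') = (m choose a') * (m - a')"
        by (metis binomial_absorption binomial_absorb_comp mult.commute)
      then show ?thesis using m Suc unfolding C_def by (simp flip: of_nat_mult add: algebra_simps)
    qed
    have CS: "real (Suc m choose a) = real (m choose a') + C"
      using Suc by (simp add: C_def)
    have open_card: "?D m (Suc n) * real (a + n + 1) = ?q ^ a' * real (n + 2) * real (m choose a')"
      using Suc.hyps(1)[OF m] Suc unfolding m[symmetric] by simp
    have close_card: "(if n > 0 then ?D m (n - 1) else 0) * real (a + n) = ?q ^ a * real n * C"
    proof (cases n)
      case (Suc n')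
      then have "m = 2 * a + n'" using Suc.hyps(2) by simp
      from Suc.hyps(1)[OF this] Suc show ?thesis
        unfolding \<open>m = 2 * a + n'\<close>[symmetric] by (simp add: C_def)
    qed simp
    \<comment> \<open>The extra factor \<open>a + n\<close>, positive since
      \<open>a = Suc a'\<close>, clears the denominators of both ballot numbers in the
      recursion.\<close>
    have "(?D (Suc m) n * real (a + n + 1)) * real (a + n) =
        ?q * (?D m (Suc n) * real (a + n + 1)) * real (a + n) +
        ((if n > 0 then ?D m (n - 1) else 0) * real (a + n)) * real (a + n + 1)"
      by (simp add: card_dyck_words_Suc algebra_simps)
    also have "\<dots> = ?q ^ a * (real (n + 2) * (real (m choose a') * real (a + n)) + real n * C * real (a + n + 1))"
      unfolding open_card close_card using Suc by (simp add: algebra_simps)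
    also have "\<dots> = ?q ^ a * real (n + 1) * (real (m choose a') * real (a + n) + C * real (a + n))"
      unfolding C' by (simp add: algebra_simps)
    also have "\<dots> = ?q ^ a * real (n + 1) * real (Suc m choose a) * real (a + n)"
      unfolding CS by (simp add: algebra_simps)
    finally show ?thesis using Suc unfolding Suc.hyps(2)[symmetric] by simp
  qed
qed

text \<open>Component \<open>J\<close> of the vector attached to a diagram by inserting the form \<open>r\<close> in every block. The first
  argument is the stack of indices at the open blocks, \<open>col\<close> is the colour of an index.\<close>

fun diagram_vector ::
    "('i \<Rightarrow> 'c) \<Rightarrow> ('i \<Rightarrow> 'i \<Rightarrow> complex) \<Rightarrow> 'i list \<Rightarrow> 'c option list \<Rightarrow> 'i list \<Rightarrow> complex"
  where
    "diagram_vector col r K [] J = (if K = [] \<and> J = [] then 1 else 0)"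
  | "diagram_vector col r K (Some c # d) (i # J) =
      (if col i = c then diagram_vector col r (i # K) d J else 0)"
  | "diagram_vector col r (k # K) (None # d) (i # J) = r k i * diagram_vector col r K d J"
  | "diagram_vector col r K (a # d) [] = 0"
  | "diagram_vector col r [] (None # d) (i # J) = 0"

text \<open>The value of a product functional on a diagram vector, computed block by block. The
  stack \<open>\<sigma>\<close> holds the functionals met at the open blocks, cut down to the colour
  of the block.\<close>

fun diagram_form ::
    "('i::finite \<Rightarrow> 'c) \<Rightarrow> ('i \<Rightarrow> 'i \<Rightarrow> complex) \<Rightarrow>
      ('i \<Rightarrow> complex) list \<Rightarrow> 'c option list \<Rightarrow> ('i \<Rightarrow> complex) list \<Rightarrow> complex"
  where
    "diagram_form col r \<sigma> [] \<phi>s = (if \<sigma> = [] \<and> \<phi>s = [] then 1 else 0)"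
  | "diagram_form col r \<sigma> (Some c # d) (\<phi> # \<phi>s) =
      diagram_form col r ((\<lambda>i. if col i = c then \<phi> i else 0) # \<sigma>) d \<phi>s"
  | "diagram_form col r (\<psi> # \<sigma>) (None # d) (\<phi> # \<phi>s) =
      (\<Sum>k\<in>UNIV. \<Sum>i\<in>UNIV. \<psi> k * \<phi> i * r k i) * diagram_form col r \<sigma> d \<phi>s"
  | "diagram_form col r \<sigma> (a # d) [] = 0"
  | "diagram_form col r [] (None # d) (\<phi> # \<phi>s) = 0"

definition elementary_tensor :: "('i \<Rightarrow> complex) list \<Rightarrow> 'i list \<Rightarrow> complex"
  where "elementary_tensor \<phi>s J = prod_list (map2 (\<lambda>\<phi> i. \<phi> i) \<phi>s J)"

lemma elementary_tensor_simps [simp]: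
  "elementary_tensor [] [] = 1"
  "elementary_tensor (\<phi> # \<phi>s) (i # J) = \<phi> i * elementary_tensor \<phi>s J"
  by (simp_all add: elementary_tensor_def)

lemma sum_rearrange:
  "(\<Sum>k\<in>A. \<Sum>K\<in>B. \<Sum>i\<in>C. \<Sum>J\<in>D. g k K i J) = (\<Sum>K\<in>B. \<Sum>J\<in>D. \<Sum>k\<in>A. \<Sum>i\<in>C. g k K i J)"
proof -
  have "(\<Sum>k\<in>A. \<Sum>K\<in>B. \<Sum>i\<in>C. \<Sum>J\<in>D. g k K i J) = (\<Sum>K\<in>B. \<Sum>k\<in>A. \<Sum>J\<in>D. \<Sum>i\<in>C. g k K i J)"
    by (subst sum.swap) (intro sum.cong refl sum.swap)
  also have "\<dots> = (\<Sum>K\<in>B. \<Sum>J\<in>D. \<Sum>k\<in>A. \<Sum>i\<in>C. g k K i J)"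
    by (intro sum.cong refl sum.swap)
  finally show ?thesis .
qed

text \<open>A product functional separates the indices, so the two indices of a block can be summed
  out as soon as the block closes.\<close>

lemma diagram_form_eq_sum:
  "diagram_form col r \<sigma> d \<phi>s =
    (\<Sum>K\<in>words (length \<sigma>). \<Sum>J\<in>words (length \<phi>s).
      elementary_tensor \<sigma> K * elementary_tensor \<phi>s J * diagram_vector col r K d J)"
proof (induction col r \<sigma> d \<phi>s rule: diagram_form.induct)
  case (1 col r \<sigma> \<phi>s)
  then show ?case
    by (cases "\<sigma> = [] \<and> \<phi>s = []") (auto simp: words_def intro!: sum.neutral)
next
  case (2 col r \<sigma> c d \<phi> \<phi>s)
  show ?case
    unfolding diagram_form.simps 2 length_Cons sum_words_Suc
    by (subst sum.swap[of _ "words (length \<sigma>)" UNIV]) (intro sum.cong refl, simp)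
next
  case (3 col r \<psi> \<sigma> d \<phi> \<phi>s)
  show ?case
    unfolding diagram_form.simps 3 length_Cons sum_words_Suc sum_distrib_left
    unfolding sum_distrib_right
    by (subst (2) sum_rearrange) (intro sum.cong refl, simp add: mult_ac)
qed (auto simp: sum_words_Suc)

text \<open>The stack \<open>K\<close> is carried along for the induction. Its top is the innermost
  open block, hence \<open>rev\<close>: an opening letter moves a factor \<open>w\<close> from
  \<open>J\<close> to the stack, and at a closing letter the two factors of the block are adjacent,
  so \<open>r\<close> contracts them. Empty \<open>K\<close> is the case of interest.\<close>

lemma diagram_vector_fixed:
  fixes w :: "'i::finite \<Rightarrow> 'i \<Rightarrow> 'a::complex_star_algebra"
  assumes col: "\<And>i j. col i \<noteq> col j \<Longrightarrow> w i j = 0"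
    and r: "\<And>i j. (\<Sum>k\<in>UNIV. \<Sum>l\<in>UNIV. r k l *\<^sub>C (w i k * w j l)) = r i j *\<^sub>C 1"
  shows "(\<Sum>K'\<in>words (length K). \<Sum>J'\<in>words (length J). diagram_vector col r K' d J' *\<^sub>C
      (tensor_power w (rev K) (rev K') * tensor_power w J J')) = diagram_vector col r K d J *\<^sub>C 1"
  using assms
proof (induction col r K d J rule: diagram_vector.induct)
  case (1 col r K J)
  then show ?case
    by (cases "K = [] \<and> J = []") (auto simp: words_def intro!: sum.neutral)
next
  case (2 col r K c d i J)
  have zero: "w i i' = 0" if "col i \<noteq> col i'" for i'
    using 2(2) that by simp
  show ?case
  proof (cases "col i = c")
    case True
    note IH = 2(1)[OF True 2(2,3)]
    have "(\<Sum>K'\<in>words (length K). \<Sum>J'\<in>words (length (i # J)). diagram_vector col r K' (Some c # d) J' *\<^sub>C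
        (tensor_power w (rev K) (rev K') * tensor_power w (i # J) J')) =
      (\<Sum>K'\<in>words (length (i # K)). \<Sum>J'\<in>words (length J). diagram_vector col r K' d J' *\<^sub>C
        (tensor_power w (rev (i # K)) (rev K') * tensor_power w J J'))"
      unfolding length_Cons sum_words_Suc
    proof (subst sum.swap[of _ UNIV "words (length K)"], intro sum.cong refl)
      fix i' :: 'i and K' J' :: "'i list" assume "K' \<in> words (length K)"
      then show "diagram_vector col r K' (Some c # d) (i' # J') *\<^sub>C
          (tensor_power w (rev K) (rev K') * tensor_power w (i # J) (i' # J')) =
        diagram_vector col r (i' # K') d J' *\<^sub>C
          (tensor_power w (rev (i # K)) (rev (i' # K')) * tensor_power w J J')"
        using True zero[of i']
        by (cases "col i' = c") (auto simp: words_def tensor_power_append mult.assoc)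
    qed
    then show ?thesis using IH True by simp
  next
    case False
    then show ?thesis
      by (auto simp: sum_words_Suc zero intro!: sum.neutral)
  qed
next
  case (3 col r k K d i J)
  note IH = 3(1)[OF 3(2,3)] and r = 3(3)
  have "(\<Sum>K'\<in>words (length (k # K)). \<Sum>J'\<in>words (length (i # J)).
      diagram_vector col r K' (None # d) J' *\<^sub>C
        (tensor_power w (rev (k # K)) (rev K') * tensor_power w (i # J) J')) =
      (\<Sum>K'\<in>words (length K). \<Sum>J'\<in>words (length J). diagram_vector col r K' d J' *\<^sub>C
        (tensor_power w (rev K) (rev K') *
          (\<Sum>k'\<in>UNIV. \<Sum>i'\<in>UNIV. r k' i' *\<^sub>C (w k k' * w i i')) * tensor_power w J J'))"
    unfolding length_Cons sum_words_Suc
      sum_distrib_left sum_distrib_right complex_vector.scale_sum_right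
    by (subst sum_rearrange) (intro sum.cong refl,
      simp add: words_def tensor_power_append scaleC_mult_left scaleC_mult_right mult.assoc mult.commute[of "r _ _"])
  also have "\<dots> = r k i *\<^sub>C (\<Sum>K'\<in>words (length K). \<Sum>J'\<in>words (length J). diagram_vector col r K' d J' *\<^sub>C
      (tensor_power w (rev K) (rev K') * tensor_power w J J'))"
    unfolding r complex_vector.scale_sum_right
    by (simp add: scaleC_mult_left scaleC_mult_right mult.commute[of "r _ _"])
  also have "\<dots> = r k i *\<^sub>C (diagram_vector col r K d J *\<^sub>C 1)"
    using IH by (rule arg_cong)
  finally show ?case by simp
qed (auto simp: sum_words_Suc)

lemma diagram_form_zero:
  "(\<lambda>_. 0) \<in> set \<sigma> \<Longrightarrow> diagram_form col r \<sigma> d \<phi>s = 0"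
  by (induction col r \<sigma> d \<phi>s rule: diagram_form.induct) auto

text \<open>Labels every opening letter of colour \<open>c\<close> by \<open>\<alpha> c\<close> and its closing letter by \<open>\<beta> c\<close>; the first
  argument is the stack of colours of the open blocks.\<close>

fun diagram_test :: "('c \<Rightarrow> 'f) \<Rightarrow> ('c \<Rightarrow> 'f) \<Rightarrow> 'c list \<Rightarrow> 'c option list \<Rightarrow> 'f list"
  where
    "diagram_test \<alpha> \<beta> s [] = []"
  | "diagram_test \<alpha> \<beta> s (Some c # d) = \<alpha> c # diagram_test \<alpha> \<beta> (c # s) d"
  | "diagram_test \<alpha> \<beta> (c # s) (None # d) = \<beta> c # diagram_test \<alpha> \<beta> s d"
  | "diagram_test \<alpha> \<beta> [] (None # d) = []"

lemma length_diagram_test: "dyck (length s) d \<Longrightarrow> length (diagram_test \<alpha> \<beta> s d) = length d"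
  by (induction \<alpha> \<beta> s d rule: diagram_test.induct) auto

text \<open>Used through \<open>lex\<close>. Two colours stay incomparable, since diagrams that
  first differ in the colour of an opening letter pair to 0.\<close>

definition open_before_close :: "('c option \<times> 'c option) set"
  where "open_before_close = {(Some c, None) | c. True}"

lemma wf_open_before_close: "wf open_before_close"
  by (rule wf_subset[of "Wellfounded.measure (\<lambda>a. if a = None then 1 else 0)"]) (auto simp: open_before_close_def)

context
  fixes col :: "'i::finite \<Rightarrow> 'c" and r :: "'i \<Rightarrow> 'i \<Rightarrow> complex" and \<alpha> \<beta> :: "'c \<Rightarrow> 'i \<Rightarrow> complex"
  assumes col: "\<And>c i. col i \<noteq> c \<Longrightarrow> \<alpha> c i = 0"
    and isotropic: "\<And>c c'. (\<Sum>k\<in>UNIV. \<Sum>i\<in>UNIV. \<alpha> c k * \<alpha> c' i * r k i) = 0"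
    and nondegenerate: "\<And>c. (\<Sum>k\<in>UNIV. \<Sum>i\<in>UNIV. \<alpha> c k * \<beta> c i * r k i) \<noteq> 0"
begin

lemma restrict_test: "(\<lambda>i. if col i = c' then \<alpha> c i else 0) = (if c' = c then \<alpha> c else (\<lambda>_. 0))"
  using col by auto

text \<open>Every block of colour \<open>c\<close> contributes the nonzero pairing of
  \<open>\<alpha> c\<close> with \<open>\<beta> c\<close>.\<close>

lemma diagram_form_diag:
  "dyck (length s) d \<Longrightarrow> diagram_form col r (map \<alpha> s) d (diagram_test \<alpha> \<beta> s d) \<noteq> 0"
proof (induction d arbitrary: s)
  case (Cons a d)
  show ?case
  proof (cases a)
    case None
    with Cons.prems obtain c s' where "s = c # s'" by (cases s) auto
    with Cons None show ?thesis by (simp add: nondegenerate)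
  next
    case (Some c)
    with Cons.IH[of "c # s"] Cons.prems show ?thesis by (simp add: restrict_test)
  qed
qed simp

text \<open>At the first letter in which two diagrams differ the open blocks agree, so a block opened by \<open>e\<close> in
  the wrong colour or closed by \<open>e\<close> against a letter that opens in \<open>d\<close> contributes zero.\<close>

lemma diagram_form_triangular:
  assumes "dyck (length s) d" "length d = length e"
    and "diagram_form col r (map \<alpha> s) e (diagram_test \<alpha> \<beta> s d) \<noteq> 0"
  shows "d = e \<or> (e, d) \<in> lex open_before_close"
  using assms
proof (induction d arbitrary: s e)
  case Nil
  then show ?case by simp
next
  case (Cons a d)
  then obtain b e' where e: "e = b # e'" "length d = length e'"
    by (cases e) auto
  show ?case
  proof (cases a)
    case (Some c)
    show ?thesis
    proof (cases b)
      case None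
      then show ?thesis using Cons.prems Some e isotropic by (cases s) auto
    next
      case b: (Some c')
      with Cons.prems(3) Some e have "c' = c"
        by (auto simp: restrict_test diagram_form_zero split: if_splits)
      with Cons.IH[of "c # s" e'] Cons.prems Some e b show ?thesis
        by (auto simp: restrict_test)
    qed
  next
    case None
    with Cons.prems(1) obtain c s' where s: "s = c # s'" by (cases s) auto
    show ?thesis
    proof (cases b)
      case b: None
      with Cons.IH[of s' e'] Cons.prems None e s show ?thesis by auto
    next
      \<comment> \<open>The only surviving kind of first difference: \<open>e\<close> opens where
        \<open>d\<close> closes, which makes \<open>e\<close> the smaller word.\<close>
      case (Some c')
      with None e show ?thesis by (auto simp: open_before_close_def)
    qed
  qed
qed

end

section \<open>The lower bound\<close>

text \<open>\<open>h\<close> vanishes on the left ideal generated by a null element.\<close>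

lemma (in positive_functional) null_vector:
  assumes "h (star a * a) = 0"
  shows "h (b * a) = 0"
  using cauchy_schwarz[of "star b" a] assms by simp

lemma sum_rotate:
  "(\<Sum>q\<in>A. \<Sum>i\<in>B. \<Sum>j\<in>C. g q i j) = (\<Sum>i\<in>B. \<Sum>j\<in>C. \<Sum>q\<in>A. g q i j)"
  by (rule trans[OF sum.swap sum.cong[OF refl sum.swap]])

lemma sum_two_point:
  fixes f :: "'n::finite \<Rightarrow> complex"
  assumes "a \<noteq> b"
  shows "(\<Sum>i\<in>UNIV. (if i = a then s else if i = b then t else 0) * f i) = s * f a + t * f b"
proof -
  have "(\<Sum>i\<in>UNIV. (if i = a then s else if i = b then t else 0) * f i) =
      (\<Sum>i\<in>{a, b}. (if i = a then s else if i = b then t else 0) * f i)"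
    by (rule sum.mono_neutral_right) auto
  then show ?thesis using assms by simp
qed

lemma binary_quadratic_zero:
  fixes a b c :: complex
  shows "\<exists>s t. (s \<noteq> 0 \<or> t \<noteq> 0) \<and> a * s\<^sup>2 + b * s * t + c * t\<^sup>2 = 0"
proof (cases "c = 0")
  case True
  then show ?thesis by (intro exI[of _ 0] exI[of _ 1]) simp
next
  case False
  define t where "t = (csqrt (b\<^sup>2 - 4 * a * c) - b) / (2 * c)"
  have "2 * c * t + b = csqrt (b\<^sup>2 - 4 * a * c)"
    using False by (simp add: t_def)
  then have "(2 * c * t + b)\<^sup>2 = b\<^sup>2 - 4 * a * c" by simp
  then have "4 * c * (a + b * t + c * t\<^sup>2) = 0"
    by (simp add: power2_eq_square algebra_simps)
  with False have "a * 1\<^sup>2 + b * 1 * t + c * t\<^sup>2 = 0" by simp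
  then show ?thesis by (intro exI[of _ 1] exI[of _ t]) simp
qed

text \<open>For \<open>CARD('n) = 2\<close> this says that \<open>F\<close> has an eigenvector \<open>x\<close>.\<close>

lemma exists_isotropic_pair:
  fixes F :: "'n::finite \<Rightarrow> 'n \<Rightarrow> complex"
  assumes "CARD('n) \<ge> 2"
  obtains x y :: "'n \<Rightarrow> complex" where "\<exists>i. x i \<noteq> 0" "\<exists>i. y i \<noteq> 0"
    "(\<Sum>i\<in>UNIV. x i * y i) = 0" "(\<Sum>i\<in>UNIV. \<Sum>j\<in>UNIV. y i * x j * F i j) = 0"
proof -
  obtain a b :: 'n where ab: "a \<noteq> b"
    using assms card_2_iff' ex_card[of 2 "UNIV :: 'n set"] by metis
  obtain s t where st: "s \<noteq> 0 \<or> t \<noteq> 0"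
    and zero: "- F b a * s\<^sup>2 + (F a a - F b b) * s * t + F a b * t\<^sup>2 = 0"
    using binary_quadratic_zero by blast
  \<comment> \<open>On two points, \<open>y\<close> is \<open>x\<close> turned by a right angle, so
    orthogonality is automatic; the other equation becomes the binary quadratic \<open>zero\<close>
    in \<open>s\<close> and \<open>t\<close>.\<close>
  define x where "x = (\<lambda>i. if i = a then s else if i = b then t else 0)"
  define y where "y = (\<lambda>i. if i = a then t else if i = b then - s else 0)"
  note sums = sum_two_point[OF ab, of s t, folded x_def[THEN fun_cong]]
    sum_two_point[OF ab, of t "- s", folded y_def[THEN fun_cong]]
  have "(\<Sum>i\<in>UNIV. \<Sum>j\<in>UNIV. y i * x j * F i j) = (\<Sum>i\<in>UNIV. y i * (\<Sum>j\<in>UNIV. x j * F i j))"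
    by (simp add: sum_distrib_left mult.assoc)
  also have "\<dots> = - F b a * s\<^sup>2 + (F a a - F b b) * s * t + F a b * t\<^sup>2"
    unfolding sums by (simp add: power2_eq_square algebra_simps)
  also have "\<dots> = 0" by (rule zero)
  finally have "(\<Sum>i\<in>UNIV. \<Sum>j\<in>UNIV. y i * x j * F i j) = 0" .
  moreover have "(\<Sum>i\<in>UNIV. x i * y i) = 0"
    unfolding sums using ab by (simp add: y_def)
  moreover have "\<exists>i. x i \<noteq> 0" "\<exists>i. y i \<noteq> 0"
    using st ab unfolding x_def y_def by (metis neg_equal_0_iff_equal)+
  ultimately show ?thesis using that by blast
qed

text \<open>The Haar average of the standard pairing between opposite colours, that is, a sum of
  columns of the idempotent belonging to words of length 2. This gives invariant vectors of
  \<open>u \<otimes> u\<^sup>c\<close> and of \<open>u\<^sup>c \<otimes> u\<close> at once.\<close>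

definition averaged_form ::
    "('a::complex_star_algebra \<Rightarrow> complex) \<Rightarrow> 'a^'n^'n \<Rightarrow> bool \<times> 'n \<Rightarrow> bool \<times> 'n \<Rightarrow> complex"
  where "averaged_form h u p q = (if fst p = fst q then 0
    else \<Sum>j\<in>UNIV. h (double_corep u p (fst p, j) * double_corep u q (fst q, j)))"

context
  fixes \<Delta> :: "'a::complex_star_algebra \<Rightarrow> ('a, 'a) tensor" and u :: "'a^'n^'n" and h
  assumes qg: "fg_discrete_quantum_group \<Delta> u"
  defines "h \<equiv> haar_state \<Delta>"
begin

lemma is_haar_state_h: "is_haar_state \<Delta> h"
  unfolding h_def by (rule haar_state_fg[OF qg])

lemma linear_haar: "clinear h"
  using is_haar_state_h by (simp add: is_haar_state_def)

lemma averaged_form_fixed: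
  "(\<Sum>k\<in>UNIV. \<Sum>l\<in>UNIV. averaged_form h u k l *\<^sub>C (double_corep u p k * double_corep u q l)) =
    averaged_form h u p q *\<^sub>C 1"
proof (cases "fst p = fst q")
  case True
  then show ?thesis
    by (auto simp: averaged_form_def double_corep_def intro!: sum.neutral)
next
  case False
  let ?w = "double_corep u"
  have haar_pair: "(\<Sum>k\<in>UNIV. \<Sum>l\<in>UNIV. h (?w k r * ?w l s) *\<^sub>C (?w p k * ?w q l)) =
      h (?w p r * ?w q s) *\<^sub>C 1" for r s
  proof -
    have mem: "[i, j] \<in> words 2" for i j :: "bool \<times> 'n"
      by (simp add: words_def)
    show ?thesis
      using corep_haar_right[OF is_haar_state_h corep_words[OF qg] mem[of p q] mem[of r s]]
      by (simp add: sum_words_Suc numeral_2_eq_2)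
  qed
  \<comment> \<open>Entries of \<open>?w\<close> between different colours vanish, so the colours of
    \<open>k\<close> and \<open>l\<close> may be replaced by those of \<open>p\<close> and
    \<open>q\<close>.\<close>
  have "averaged_form h u k l *\<^sub>C (?w p k * ?w q l) =
      (\<Sum>j\<in>UNIV. h (?w k (fst p, j) * ?w l (fst q, j))) *\<^sub>C (?w p k * ?w q l)" for k l
    using False by (cases "fst k = fst p \<and> fst l = fst q") (auto simp: averaged_form_def double_corep_def)
  then have "(\<Sum>k\<in>UNIV. \<Sum>l\<in>UNIV. averaged_form h u k l *\<^sub>C (?w p k * ?w q l)) =
      (\<Sum>k\<in>UNIV. \<Sum>l\<in>UNIV. \<Sum>j\<in>UNIV. h (?w k (fst p, j) * ?w l (fst q, j)) *\<^sub>C (?w p k * ?w q l))"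
    by (simp add: complex_vector.scale_sum_left)
  also have "\<dots> = (\<Sum>j\<in>UNIV. \<Sum>k\<in>UNIV. \<Sum>l\<in>UNIV. h (?w k (fst p, j) * ?w l (fst q, j)) *\<^sub>C (?w p k * ?w q l))"
    by (rule sum_rotate[symmetric])
  also have "\<dots> = averaged_form h u p q *\<^sub>C 1"
    unfolding haar_pair using False by (simp add: averaged_form_def complex_vector.scale_sum_left)
  finally show ?thesis .
qed

lemma averaged_form_True_False: "averaged_form h u (True, i) (False, j) = (if i = j then 1 else 0)"
proof -
  have "u ** adjoint_matrix u = mat 1"
    using qg by (simp add: compact_matrix_quantum_group_def unitary_matrix_def)
  then have "(\<Sum>k\<in>UNIV. u $ i $ k * star (u $ j $ k)) = (if i = j then 1 else 0)"
    by (simp add: vec_eq_iff matrix_matrix_mult_def adjoint_matrix_def mat_def)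
  then have "h (\<Sum>k\<in>UNIV. u $ i $ k * star (u $ j $ k)) = h (if i = j then 1 else 0)"
    by simp
  then show ?thesis
    using is_haar_state_h clinear_zero[OF linear_haar]
    by (auto simp: averaged_form_def double_corep_def clinear_sum[OF linear_haar] is_haar_state_def)
qed

text \<open>If the value vanished, \<open>h\<close> would annihilate the left ideal generated by the entries of the row vector \<open>cnj y * u\<close>,
  which contains a nonzero scalar since \<open>u\<^sup>c\<close> is invertible.\<close>

lemma averaged_form_False_True:
  assumes "y i \<noteq> 0"
  shows "(\<Sum>i\<in>UNIV. \<Sum>j\<in>UNIV. y i * cnj (y j) * averaged_form h u (False, i) (True, j)) \<noteq> 0"
proof
  interpret positive_functional h
    by (rule haar_positive_functional[OF is_haar_state_h])
  define z where "z = (\<lambda>q. \<Sum>j\<in>UNIV. cnj (y j) *\<^sub>C u $ j $ q)"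
  assume zero: "(\<Sum>i\<in>UNIV. \<Sum>j\<in>UNIV. y i * cnj (y j) * averaged_form h u (False, i) (True, j)) = 0"
  have norm_z: "h (star (z q) * z q) =
      (\<Sum>i\<in>UNIV. \<Sum>j\<in>UNIV. y i * cnj (y j) * h (star (u $ i $ q) * u $ j $ q))" for q
    by (simp add: z_def star_sum star_scaleC sum_product clinear_sum[OF linear_haar]
        clinearD[OF linear_haar] scaleC_mult_left scaleC_mult_right scaleC_complex_def mult_ac)
  have "(\<Sum>q\<in>UNIV. h (star (z q) * z q)) =
      (\<Sum>i\<in>UNIV. \<Sum>j\<in>UNIV. \<Sum>q\<in>UNIV. y i * cnj (y j) * h (star (u $ i $ q) * u $ j $ q))"
    unfolding norm_z by (rule sum_rotate)
  also have "\<dots> = 0"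
    using zero by (simp add: averaged_form_def double_corep_def sum_distrib_left)
  finally have "(\<Sum>q\<in>UNIV. Re (h (star (z q) * z q))) = 0"
    by (simp flip: Re_sum)
  moreover have "0 \<le> Re (h (star (z q) * z q))" "Im (h (star (z q) * z q)) = 0" for q
    using positive[of "z q"] by (simp_all add: complex_nonneg_Reals_iff)
  ultimately have "h (star (z q) * z q) = 0" for q
    by (simp add: sum_nonneg_eq_0_iff complex_eq_iff)
  then have null: "h (b * z q) = 0" for b q
    by (rule null_vector)
  obtain B where "conj_matrix u ** B = mat 1"
    using qg unfolding compact_matrix_quantum_group_def invertible_def by blast
  then have "(\<Sum>q\<in>UNIV. star (u $ j $ q) * B $ q $ i) = (if j = i then 1 else 0)" for j
    by (simp add: vec_eq_iff matrix_matrix_mult_def conj_matrix_def mat_def)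
  then have "star (\<Sum>q\<in>UNIV. star (u $ j $ q) * B $ q $ i) = (if j = i then 1 else 0)" for j
    by simp
  \<comment> \<open>The involution moves the inverse to the left of \<open>u\<close>, so the
    combination of the \<open>z q\<close> below lies in the left ideal annihilated by
    \<open>h\<close>.\<close>
  then have inv: "(\<Sum>q\<in>UNIV. star (B $ q $ i) * u $ j $ q) = (if j = i then 1 else 0)" for j
    by (simp add: star_sum star_mult)
  have "(\<Sum>q\<in>UNIV. star (B $ q $ i) * z q) =
      (\<Sum>j\<in>UNIV. cnj (y j) *\<^sub>C (\<Sum>q\<in>UNIV. star (B $ q $ i) * u $ j $ q))"
    unfolding z_def sum_distrib_left complex_vector.scale_sum_right scaleC_mult_right
    by (rule sum.swap)
  also have "\<dots> = cnj (y i) *\<^sub>C 1"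
    unfolding inv by (simp add: if_distrib[of "(*\<^sub>C) _"] sum.delta cong: if_cong)
  finally have "h (cnj (y i) *\<^sub>C 1) = 0"
    using null by (metis (no_types, lifting) clinear_sum[OF linear_haar] sum.neutral)
  then show False
    using is_haar_state_h assms by (simp add: clinearD[OF linear_haar] is_haar_state_def scaleC_complex_def)
qed

text \<open>The form vanishes within a colour, and isotropy between the two colours is the pair of
  equations solved by \<open>exists_isotropic_pair\<close>. This is where \<open>n \<ge> 2\<close>
  enters: for size one, \<open>x i * y i = 0\<close> would make \<open>x\<close> or \<open>y\<close>
  vanish.\<close>

lemma exists_test_functionals:
  assumes "CARD('n) \<ge> 2"
  obtains \<alpha> \<beta> :: "bool \<Rightarrow> bool \<times> 'n \<Rightarrow> complex"
  where "\<And>c p. fst p \<noteq> c \<Longrightarrow> \<alpha> c p = 0"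
    and "\<And>c c'. (\<Sum>p\<in>UNIV. \<Sum>q\<in>UNIV. \<alpha> c p * \<alpha> c' q * averaged_form h u p q) = 0"
    and "\<And>c. (\<Sum>p\<in>UNIV. \<Sum>q\<in>UNIV. \<alpha> c p * \<beta> c q * averaged_form h u p q) \<noteq> 0"
proof -
  obtain x y :: "'n \<Rightarrow> complex" where xy: "\<exists>i. x i \<noteq> 0" "\<exists>i. y i \<noteq> 0" "(\<Sum>i\<in>UNIV. x i * y i) = 0"
      "(\<Sum>i\<in>UNIV. \<Sum>j\<in>UNIV. y i * x j * averaged_form h u (False, i) (True, j)) = 0"
    by (rule exists_isotropic_pair[OF assms, where F = "\<lambda>i j. averaged_form h u (False, i) (True, j)"])
  define \<alpha> where "\<alpha> = (\<lambda>c p. if fst p = c then (if c then x (snd p) else y (snd p)) else 0)"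
  \<comment> \<open>\<open>\<beta> c\<close> is the conjugate of \<open>\<alpha> c\<close> moved to
    the opposite colour. The pairing is then the squared norm of \<open>x\<close> for
    \<open>True\<close>, and the value in \<open>averaged_form_False_True\<close> for
    \<open>False\<close>.\<close>
  define \<beta> where "\<beta> = (\<lambda>c p. if fst p = c then 0 else cnj (if c then x (snd p) else y (snd p)))"
  have same: "averaged_form h u (c, i) (c, j) = 0" for c i j
    by (simp add: averaged_form_def)
  have "\<exists>i. y i \<noteq> 0" by (rule xy)
  then have "(\<Sum>i\<in>UNIV. \<Sum>j\<in>UNIV. y i * cnj (y j) * averaged_form h u (False, i) (True, j)) \<noteq> 0"
    using averaged_form_False_True by blast
  moreover have "(\<Sum>i\<in>UNIV. x i * cnj (x i)) \<noteq> 0"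
  proof
    assume "(\<Sum>i\<in>UNIV. x i * cnj (x i)) = 0"
    then have "complex_of_real (\<Sum>i\<in>UNIV. (cmod (x i))\<^sup>2) = 0"
      unfolding of_real_sum complex_norm_square .
    then have "(\<Sum>i\<in>UNIV. (cmod (x i))\<^sup>2) = 0" by (simp only: of_real_eq_0_iff)
    then show False using xy(1) by (simp add: sum_nonneg_eq_0_iff)
  qed
  ultimately have "(\<Sum>p\<in>UNIV. \<Sum>q\<in>UNIV. \<alpha> c p * \<beta> c q * averaged_form h u p q) \<noteq> 0" for c
    by (cases c)
      (simp_all add: sum_UNIV_bool_times \<alpha>_def \<beta>_def same averaged_form_True_False if_distrib sum.delta cong: if_cong)
  moreover have "(\<Sum>p\<in>UNIV. \<Sum>q\<in>UNIV. \<alpha> c p * \<alpha> c' q * averaged_form h u p q) = 0" for c c'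
    using xy(3,4)
    by (cases c; cases c')
      (simp_all add: sum_UNIV_bool_times \<alpha>_def same averaged_form_True_False if_distrib sum.delta cong: if_cong)
  moreover have "\<alpha> c p = 0" if "fst p \<noteq> c" for c p
    using that by (simp add: \<alpha>_def)
  ultimately show ?thesis by (intro that[of \<alpha> \<beta>])
qed

lemma character_moment_ge:
  assumes "CARD('n) \<ge> 2"
  shows "real (card (dyck_words k 0 :: bool option list set)) \<le> Re (character_moment \<Delta> u k)"
proof (rule exists_test_functionals[OF assms])
  fix \<alpha> \<beta> :: "bool \<Rightarrow> bool \<times> 'n \<Rightarrow> complex"
  assume \<alpha>\<beta>: "\<And>c p. fst p \<noteq> c \<Longrightarrow> \<alpha> c p = 0"
      "\<And>c c'. (\<Sum>p\<in>UNIV. \<Sum>q\<in>UNIV. \<alpha> c p * \<alpha> c' q * averaged_form h u p q) = 0"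
      "\<And>c. (\<Sum>p\<in>UNIV. \<Sum>q\<in>UNIV. \<alpha> c p * \<beta> c q * averaged_form h u p q) \<noteq> 0"
  let ?D = "dyck_words k 0 :: bool option list set"
  let ?w = "tensor_power (double_corep u)"
  define \<xi> where "\<xi> = diagram_vector fst (averaged_form h u) []"
  define \<theta> where "\<theta> = (\<lambda>d. elementary_tensor (diagram_test \<alpha> \<beta> [] d))"
  \<comment> \<open>No block is open at the start, so the sum over stacks in
    \<open>diagram_form_eq_sum\<close> reduces to the empty word.\<close>
  have pairing: "(\<Sum>J\<in>words k. \<theta> d J * \<xi> e J) =
      diagram_form fst (averaged_form h u) (map \<alpha> []) e (diagram_test \<alpha> \<beta> [] d)" if "d \<in> ?D" for d e
    using that length_diagram_test[where s = "[]" and d = d and \<alpha> = \<alpha> and \<beta> = \<beta>]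
    by (simp add: diagram_form_eq_sum \<theta>_def \<xi>_def dyck_words_def words_def)
  have "double_corep u p q = 0" if "fst p \<noteq> fst q" for p q
    using that by (simp add: double_corep_def)
  note diagram_fixed = diagram_vector_fixed[where col = fst, OF this averaged_form_fixed]
  have fixed: "(\<Sum>J\<in>words k. \<xi> d J *\<^sub>C ?w I J) = \<xi> d I *\<^sub>C 1" if "I \<in> words k" for d I
  proof -
    have "k = length I" using that by (simp add: words_def)
    then show ?thesis
      using diagram_fixed[where K = "[]" and J = I and d = d] by (simp add: \<xi>_def)
  qed
  have "\<exists>m. (\<Sum>I\<in>words k. h (?w I I)) = of_nat (card ?D + m)"
  proof (rule card_le_idempotent_on_trace[where R = "lex open_before_close"
        and P = "\<lambda>I J. h (?w I J)" and \<xi> = \<xi> and \<theta> = \<theta>])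
    show "idempotent_on (words k) (\<lambda>I J. h (?w I J))"
      by (rule corep_haar_idempotent[OF is_haar_state_h corep_words[OF qg]])
    show "(\<Sum>J\<in>words k. h (?w I J) * \<xi> d J) = \<xi> d I" if "I \<in> words k" for d I
      by (rule corep_haar_fixed[OF is_haar_state_h corep_words[OF qg] fixed that])
    fix d assume d: "d \<in> ?D"
    show "(\<Sum>J\<in>words k. \<theta> d J * \<xi> d J) \<noteq> 0"
      unfolding pairing[OF d] using d
      by (intro diagram_form_diag[OF \<alpha>\<beta>]) (auto simp: dyck_words_def)
    fix e assume "e \<in> ?D" "(\<Sum>J\<in>words k. \<theta> d J * \<xi> e J) \<noteq> 0"
    then show "d = e \<or> (e, d) \<in> lex open_before_close"
      unfolding pairing[OF d] using d
      by (intro diagram_form_triangular[where s = "[]", OF \<alpha>\<beta>]) (auto simp: dyck_words_def words_def)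
  qed (auto intro: wf_open_before_close)
  then obtain m where "character_moment \<Delta> u k = of_nat (card ?D + m)"
    unfolding character_moment_trace[OF qg] h_def by blast
  then show ?thesis by simp
qed

end

text \<open>With no block open the ballot number is a Catalan number, and the central binomial
  coefficient is at least \<open>4 ^ k / (2 * k)\<close>. The polynomial loss disappears under the
  \<open>2 * k\<close>-th root.\<close>

lemma card_dyck_words_ge:
  assumes "k > 0"
  shows "8 ^ k / (2 * real k * (real k + 1)) \<le> real (card (dyck_words (2 * k) 0 :: bool option list set))"
proof -
  have "8 ^ k / (2 * real k) = 2 ^ k * (4 ^ k / (2 * real k))"
    by (simp flip: power_mult_distrib)
  also have "\<dots> \<le> 2 ^ k * real ((2 * k) choose k)"
    by (intro mult_left_mono central_binomial_lower_bound assms) simp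
  also have "\<dots> = real (card (dyck_words (2 * k) 0 :: bool option list set)) * (real k + 1)"
    using card_dyck_words[of k 0, where 'c = bool] by (simp add: algebra_simps)
  finally show ?thesis
    unfolding divide_divide_eq_left[symmetric] by (subst pos_divide_le_eq) simp_all
qed

lemma character_norm_ge:
  fixes u :: "'a::complex_star_algebra^'n^'n"
  assumes "fg_discrete_quantum_group \<Delta> u" "CARD('n) \<ge> 2"
  shows "2 * sqrt 2 \<le> character_norm \<Delta> u"
proof (rule LIMSEQ_le[OF _ character_norm_LIMSEQ[OF assms(1)]])
  have "(\<lambda>k. (8 ^ k / (2 * real k * (real k + 1))) powr (1 / (2 * real k))) \<longlonglongrightarrow> 2 * sqrt 2"
  proof -
    \<comment> \<open>The limit is the square root of 8, put in exponential form for the asymptotic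
      computation.\<close>
    have "exp (ln 8 / 2) = (8 :: real) powr (1 / 2)"
      by (simp add: powr_def)
    also have "\<dots> = 2 * sqrt 2"
      using real_sqrt_mult[of 4 2] by (simp add: powr_half_sqrt)
    finally have "2 * sqrt 2 = exp (ln 8 / 2 :: real)" ..
    then show ?thesis by (simp only:) real_asymp
  qed
  moreover have "eventually (\<lambda>k. (8 ^ k / (2 * real k * (real k + 1))) powr (1 / (2 * real k)) =
      root (2 * k) (8 ^ k / (2 * real k * (real k + 1)))) sequentially"
    using eventually_gt_at_top[of 0] by eventually_elim (simp add: root_powr_inverse)
  ultimately show "(\<lambda>k. root (2 * k) (8 ^ k / (2 * real k * (real k + 1)))) \<longlonglongrightarrow> 2 * sqrt 2"
    by (rule Lim_transform_eventually)
  show "\<exists>N. \<forall>k\<ge>N. root (2 * k) (8 ^ k / (2 * real k * (real k + 1))) \<le>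
      root (2 * k) (Re (character_moment \<Delta> u (2 * k)))"
    using order_trans[OF card_dyck_words_ge character_moment_ge[OF assms]]
    by (intro exI[of _ 1] allI impI real_root_le_mono) auto
qed

theorem proposition4p1:
  fixes \<Delta>\<^sub>1 :: "'a::complex_star_algebra \<Rightarrow> ('a, 'a) tensor" and u :: "'a^'n^'n"
    and \<Delta>\<^sub>2 :: "'b::complex_star_algebra \<Rightarrow> ('b, 'b) tensor" and v :: "'b^'n^'n"
  shows "(fg_discrete_quantum_group \<Delta>\<^sub>1 u \<and> fg_discrete_quantum_group \<Delta>\<^sub>2 v \<and> is_quotient_of u v
        \<longrightarrow> character_norm \<Delta>\<^sub>2 v \<le> character_norm \<Delta>\<^sub>1 u) \<and>
    (CARD('n) \<ge> 2 \<and> fg_discrete_quantum_group \<Delta>\<^sub>1 u \<longrightarrow> 2 * sqrt 2 \<le> character_norm \<Delta>\<^sub>1 u)"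
  using character_norm_quotient_le character_norm_ge by blast

end
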